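(* There exist numerical (absolute) constants $C,C_1,C_2>0$ such that the following holds in the setting described in the context. Let $N\ge 1$, let $\beta_i=\bar\beta\ge 2L$ for all $i=0,1,\dots$, let $1\le\tau\le N/\upsilon^2$ (only $\tau\ge 1$ is required if $\upsilon=0$), and let $$\lambda=\max\left\{\sigma\sqrt{\frac N\tau},\,M\right\}+\upsilon\sigma .$$ Let $\widehat x_N$ be the weighted average of the RSMD iterations $x_1,\dots,x_N$ run with these parameters. Then there is a random event $\mathcal A_N\subset\Omega^{\otimes N}$ of probability at least $1-2e^{-\tau}$ such that for all $\omega^N=(\omega_1,\dots,\omega_N)\in\mathcal A_N$ $$F(\widehat x_N)-F_*\le\frac{\bar\beta}{N}\sup_{z\in X}\varepsilon(x^N,z)\le\frac CN\left(\bar\beta R^2\Theta+R\max\{\sigma\sqrt{\tau N},\,M\tau\}+\bar\beta^{-1}\max\{N\sigma^2,\,M^2\tau\}\right).$$ In particular, choosing $\bar\beta=\max\left\{2L,\frac{\sigma\sqrt N}{R\sqrt\Theta}\right\}$ we have, for all $\omega^N\in\mathcal A_N$, $$F(\widehat x_N)-F_*\le\max\left\{C_1\frac{LR^2[\tau\vee\Theta]}{N},\;C_2\,\sigma R\sqrt{\frac{\tau\vee\Theta}{N}}\right\}.$$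
   Context: **Problem.** $E$ is a finite-dimensional real vector space with norm $\|\cdot\|$; $E^*$ is its dual, $\langle s,x\rangle$ is the value of $s\in E^*$ at $x\in E$, and $\|s\|_*=\max\{\langle s,x\rangle:\|x\|\le1\}$. $X\subset E$ is a nonempty convex compact set. $\omega$ is a random variable on $\Omega$ with distribution $P$, $\Phi:X\times\Omega\to\mathbf R$, and $\phi(x)=\mathbf E\{\Phi(x,\omega)\}$ is finite for all $x\in X$, convex on $X$, differentiable at each point of $X$, with $\|\nabla\phi(x')-\nabla\phi(x)\|_*\le L\|x-x'\|$ for all $x,x'\in X$ ($L>0$ a constant). $\psi$ is convex and continuous on $X$. Put $F=\phi+\psi$ and $F_*=\min_{x\in X}F(x)$. **Oracle.** $G:X\times\Omega\to E^*$ satisfies, for all $x\in X$, $\mathbf E\{G(x,\omega)\}=\nabla\phi(x)$ and $\mathbf E\{\|G(x,\omega)-\nabla\phi(x)\|_*^2\}\le\sigma^2$ with a constant $\sigma>0$. A point $\bar x\in X$ and a vector $g(\bar x)\in E^*$ are given with $\|g(\bar x)-\nabla\phi(\bar x)\|_*\le\upsilon\sigma$, $\upsilon\ge0$ a constant. **Proxy function.** $B=\{x\in E:\|x\|\le1\}$; $\theta:B\to\mathbf R$ is continuous and convex; $\theta'(\cdot)$ is a continuous selection of subgradients of $\theta$ on $B^o=\{x\in B:\partial\theta(x)\ne\emptyset\}$, with $\langle\theta'(x)-\theta'(x'),x-x'\rangle\ge\|x-x'\|^2$ for all $x,x'$ where $\theta'$ is defined; $0=\mathrm{argmin}_{x\in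 B}\theta(x)$; $\Theta=\max_B\theta-\min_B\theta$ (so $\Theta\ge\frac12$). Let $x_0\in X$ and $R>0$ be such that $\max_{x\in X}\|x-x_0\|\le R$. Put $\vartheta(x)=R^2\theta((x-x_0)/R)$, $\vartheta'(x)=R\,\theta'((x-x_0)/R)$, and $V_x(z)=\vartheta(z)-\vartheta(x)-\langle\vartheta'(x),z-x\rangle$ for $z,x\in X$ (with $x$ such that $\vartheta'(x)$ is defined). Put $M=LR$; $a\vee b=\max\{a,b\}$. **RSMD (Robust Stochastic Mirror Descent).** For $\beta>0$ let $\mathrm{Prox}_{\beta,x}(\xi)=\mathrm{argmin}_{z\in X}\{\langle\xi,z\rangle+\psi(z)+\beta V_x(z)\}$. Let $\omega_1,\omega_2,\dots$ be i.i.d. with distribution $P$. Given $\beta_i>0$ and $\lambda>0$, starting from $x_0$, for $i=1,2,\dots$, $$x_i=\mathrm{Prox}_{\beta_{i-1},x_{i-1}}(y_i),\qquad y_i=\begin{cases}G(x_{i-1},\omega_i)&\text{if }\|G(x_{i-1},\omega_i)-g(\bar x)\|_*\le L\|\bar x-x_{i-1}\|+\lambda+\upsilon\sigma,\\ g(\bar x)&\text{otherwise.}\end{cases}$$ The approximate solution is $\widehat x_N=\left[\sum_{i=1}^N\beta_{i-1}^{-1}\right]^{-1}\sum_{i=1}^N\beta_{i-1}^{-1}x_i$. With $x^N=(x_0,\dots,x_N)$ put $$\varepsilon(x^N,z)=\sum_{i=1}^N\left\{\beta_{i-1}^{-1}\left[\langle\nabla\phi(x_{i-1}),x_i-z\rangle+\psi(x_i)-\psi(z)\right]+\tfrac12V_{x_{i-1}}(x_i)\right\}.$$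 $\Omega^{\otimes N}$ carries the law of $(\omega_1,\dots,\omega_N)$. *)

theory Defs
  imports "HOL-Probability.Probability"
begin

text \<open>Second countability is needed to take Bochner integrals with values in a dual space.\<close>

instance blinfun :: (euclidean_space, euclidean_space) second_countable_topology
proof
  define D :: "('a \<Rightarrow>\<^sub>L 'b) set" where
    "D = (\<lambda>f. blinfun_of_matrix (\<lambda>i j. f (i, j))) ` (PiE (Basis \<times> Basis) (\<lambda>_. \<rat>))"
  define B :: "('a \<Rightarrow>\<^sub>L 'b) set set" where
    "B = (\<lambda>(d, n). ball d (inverse (real (Suc n)))) ` (D \<times> UNIV)"
  have "countable D"
    unfolding D_def by (intro countable_image countable_PiE) (auto simp: countable_rat)
  then have cB: "countable B"
    unfolding B_def by (intro countable_image countable_SIGMA) auto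
  have dense: "\<exists>d\<in>D. dist d f < e" if e: "0 < e" for f :: "'a \<Rightarrow>\<^sub>L 'b" and e
  proof -
    define k where "k = real (DIM('b)) * real (DIM('a))"
    have k: "0 < k" by (simp add: k_def)
    have "\<exists>q. q \<in> \<rat> \<and> \<bar>q - f j \<bullet> i\<bar> < e / k" for i j
    proof -
      obtain r where "f j \<bullet> i < of_rat r" "of_rat r < f j \<bullet> i + e / k"
        using of_rat_dense[of "f j \<bullet> i" "f j \<bullet> i + e / k"] k e by force
      then show ?thesis by (intro exI[of _ "of_rat r"]) auto
    qed
    then have "\<exists>q. \<forall>i j. q i j \<in> \<rat> \<and> \<bar>q i j - f j \<bullet> i\<bar> < e / k"
      by (intro choice allI)
    then obtain q where q: "\<And>i j. q i j \<in> \<rat>" "\<And>i j. \<bar>q i j - f j \<bullet> i\<bar> < e / k" by blast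
    define p where "p = restrict (\<lambda>(i, j). q i j) (Basis \<times> Basis)"
    define d :: "'a \<Rightarrow>\<^sub>L 'b" where "d = blinfun_of_matrix (\<lambda>i j. p (i, j))"
    have "p \<in> PiE (Basis \<times> Basis) (\<lambda>_. \<rat>)"
      using q by (auto simp: p_def)
    then have "d \<in> D" by (auto simp: D_def d_def)
    have "norm (d - f) = norm (d - blinfun_of_matrix (\<lambda>i j. f j \<bullet> i))"
      by (simp add: blinfun_of_matrix_works)
    also have "\<dots> = norm (blinfun_of_matrix (\<lambda>i j. p (i, j) - f j \<bullet> i) :: 'a \<Rightarrow>\<^sub>L 'b)"
      by (simp add: d_def blinfun_of_matrix_minus fun_diff_def)
    also have "\<dots> \<le> (\<Sum>i\<in>Basis. \<Sum>j\<in>Basis. \<bar>p (i, j) - f j \<bullet> i\<bar>)"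
      by (rule norm_blinfun_of_matrix)
    also have "\<dots> < (\<Sum>i\<in>(Basis :: 'b set). \<Sum>j\<in>(Basis :: 'a set). e / k)"
      by (intro sum_strict_mono) (auto simp: p_def q)
    also have "\<dots> = e" using k by (simp add: k_def)
    finally show ?thesis using \<open>d \<in> D\<close> by (auto simp: dist_norm)
  qed
  have "topological_basis B"
  proof (rule topological_basisI)
    fix U assume "U \<in> B" then show "open U" by (auto simp: B_def)
  next
    fix U and f :: "'a \<Rightarrow>\<^sub>L 'b" assume "open U" "f \<in> U"
    then obtain e where e: "0 < e" "ball f e \<subseteq> U" by (meson open_contains_ball)
    obtain n where n: "inverse (real (Suc n)) < e / 2"
      using reals_Archimedean[of "e / 2"] e by auto
    obtain d where d: "d \<in> D" "dist d f < inverse (real (Suc n))"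
      using dense[of "inverse (real (Suc n))" f] by auto
    have "ball d (inverse (real (Suc n))) \<subseteq> ball f e"
    proof
      fix g assume "g \<in> ball d (inverse (real (Suc n)))"
      then show "g \<in> ball f e"
        using d n dist_triangle[of f g d] by (simp add: dist_commute)
    qed
    then show "\<exists>U'\<in>B. f \<in> U' \<and> U' \<subseteq> U"
      using d e unfolding B_def by (intro bexI[of _ "ball d (inverse (real (Suc n)))"]) auto
  qed
  then show "\<exists>B :: ('a \<Rightarrow>\<^sub>L 'b) set set. countable B \<and> open = generate_topology B"
    using cB topological_basis_imp_subbasis by blast
qed

text \<open>
  The space $E$ is a type of class \<open>euclidean_space\<close>, which supplies only the vector space
  structure and the (norm-independent) topology, Borel sets and derivatives; the norm of the
  problem is an arbitrary norm \<open>nrm\<close> on it, unrelated to the class norm. The dual $E^*$ is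
  \<open>'e \<Rightarrow>\<^sub>L real\<close>, measured by \<open>dual_norm nrm\<close> and not by the operator norm of that type.
\<close>

definition is_norm :: "('e::real_vector \<Rightarrow> real) \<Rightarrow> bool" where
  "is_norm nrm \<longleftrightarrow>
     (\<forall>x. 0 \<le> nrm x) \<and> (\<forall>x. nrm x = 0 \<longleftrightarrow> x = 0) \<and>
     (\<forall>a x. nrm (a *\<^sub>R x) = \<bar>a\<bar> * nrm x) \<and> (\<forall>x y. nrm (x + y) \<le> nrm x + nrm y)"

definition unit_ball :: "('e \<Rightarrow> real) \<Rightarrow> 'e set" where
  "unit_ball nrm = {x. nrm x \<le> 1}"

definition dual_norm :: "('e::euclidean_space \<Rightarrow> real) \<Rightarrow> ('e \<Rightarrow>\<^sub>L real) \<Rightarrow> real" where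
  "dual_norm nrm s = (SUP x\<in>unit_ball nrm. s x)"

text \<open>Subgradients are taken relative to the domain \<open>B\<close> of \<open>\<theta>\<close>, i.e. \<open>\<theta>\<close> is $+\infty$ outside \<open>B\<close>.\<close>

definition subdifferential ::
    "('e::euclidean_space \<Rightarrow> real) \<Rightarrow> 'e set \<Rightarrow> 'e \<Rightarrow> ('e \<Rightarrow>\<^sub>L real) set" where
  "subdifferential \<theta> B x = {s :: 'e \<Rightarrow>\<^sub>L real. \<forall>z\<in>B. \<theta> x + s (z - x) \<le> \<theta> z}"

definition subdiff_domain :: "('e::euclidean_space \<Rightarrow> real) \<Rightarrow> 'e set \<Rightarrow> 'e set" where
  "subdiff_domain \<theta> B = {x \<in> B. subdifferential \<theta> B x \<noteq> {}}"

definition expected_value :: "'w measure \<Rightarrow> ('e \<Rightarrow> 'w \<Rightarrow> real) \<Rightarrow> 'e \<Rightarrow> real" where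
  "expected_value P \<Phi> x = (\<integral>w. \<Phi> x w \<partial>P)"

text \<open>
  \<open>\<Phi>\<close>, \<open>\<psi>\<close>, \<open>G\<close> are used on \<open>X\<close> only, and \<open>\<theta>\<close> on the unit ball only. Since \<open>\<phi>\<close> lives on \<open>X\<close>,
  differentiability is within \<open>X\<close>; when \<open>X\<close> has empty interior this does not determine the
  gradient, so the gradient map \<open>d\<phi>\<close> is part of the data. Joint measurability of \<open>G\<close> is what
  makes the iterates of the algorithm random variables.
\<close>

locale rsmd_setting = prob_space P
  for P :: "'w measure" +
  fixes nrm :: "'e::euclidean_space \<Rightarrow> real"
    and X :: "'e set"
    and \<Phi> :: "'e \<Rightarrow> 'w \<Rightarrow> real"
    and d\<phi> :: "'e \<Rightarrow> 'e \<Rightarrow>\<^sub>L real"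
    and \<psi> :: "'e \<Rightarrow> real"
    and L :: real
    and G :: "'e \<Rightarrow> 'w \<Rightarrow> 'e \<Rightarrow>\<^sub>L real"
    and \<sigma> :: real
    and xbar :: 'e
    and gbar :: "'e \<Rightarrow>\<^sub>L real"
    and \<upsilon> :: real
    and \<theta> :: "'e \<Rightarrow> real"
    and \<theta>' :: "'e \<Rightarrow> 'e \<Rightarrow>\<^sub>L real"
    and x0 :: 'e
    and R :: real
  assumes nrm: "is_norm nrm"
    and X: "X \<noteq> {}" "convex X" "compact X"
    and \<Phi>_integrable: "\<And>x. x \<in> X \<Longrightarrow> integrable P (\<Phi> x)"
    and \<phi>_convex: "convex_on X (expected_value P \<Phi>)"
    and \<phi>_deriv: "\<And>x. x \<in> X \<Longrightarrow> (expected_value P \<Phi> has_derivative d\<phi> x) (at x within X)"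
    and L_pos: "0 < L"
    and d\<phi>_lipschitz:
      "\<And>x x'. x \<in> X \<Longrightarrow> x' \<in> X \<Longrightarrow> dual_norm nrm (d\<phi> x' - d\<phi> x) \<le> L * nrm (x - x')"
    and \<psi>: "convex_on X \<psi>" "continuous_on X \<psi>"
    and G_measurable: "(\<lambda>(x, w). G x w) \<in> borel_measurable (restrict_space borel X \<Otimes>\<^sub>M P)"
    and G_integrable: "\<And>x. x \<in> X \<Longrightarrow> integrable P (G x)"
    and G_unbiased: "\<And>x. x \<in> X \<Longrightarrow> (\<integral>w. G x w \<partial>P) = d\<phi> x"
    and G_square_integrable:
      "\<And>x. x \<in> X \<Longrightarrow> integrable P (\<lambda>w. (dual_norm nrm (G x w - d\<phi> x))\<^sup>2)"
    and G_variance: "\<And>x. x \<in> X \<Longrightarrow> (\<integral>w. (dual_norm nrm (G x w - d\<phi> x))\<^sup>2 \<partial>P) \<le> \<sigma>\<^sup>2"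
    and \<sigma>_pos: "0 < \<sigma>"
    and xbar: "xbar \<in> X"
    and \<upsilon>_nonneg: "0 \<le> \<upsilon>"
    and gbar: "dual_norm nrm (gbar - d\<phi> xbar) \<le> \<upsilon> * \<sigma>"
    and \<theta>: "continuous_on (unit_ball nrm) \<theta>" "convex_on (unit_ball nrm) \<theta>"
    and \<theta>'_subgradient:
      "\<And>x. x \<in> subdiff_domain \<theta> (unit_ball nrm) \<Longrightarrow> \<theta>' x \<in> subdifferential \<theta> (unit_ball nrm) x"
    and \<theta>'_continuous: "continuous_on (subdiff_domain \<theta> (unit_ball nrm)) \<theta>'"
    and \<theta>'_strongly_monotone:
      "\<And>x x'. x \<in> subdiff_domain \<theta> (unit_ball nrm) \<Longrightarrow> x' \<in> subdiff_domain \<theta> (unit_ball nrm) \<Longrightarrow>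
        (nrm (x - x'))\<^sup>2 \<le> (\<theta>' x - \<theta>' x') (x - x')"
    and \<theta>_argmin: "is_arg_min \<theta> (\<lambda>x. x \<in> unit_ball nrm) 0"
    and x0: "x0 \<in> X"
    and R_pos: "0 < R"
    and R_bound: "\<And>x. x \<in> X \<Longrightarrow> nrm (x - x0) \<le> R"

definition proxy_range :: "('e \<Rightarrow> real) \<Rightarrow> ('e \<Rightarrow> real) \<Rightarrow> real" where
  "proxy_range nrm \<theta> = (SUP x\<in>unit_ball nrm. \<theta> x) - (INF x\<in>unit_ball nrm. \<theta> x)"

definition scaled_proxy :: "('e::real_vector \<Rightarrow> real) \<Rightarrow> 'e \<Rightarrow> real \<Rightarrow> 'e \<Rightarrow> real" where
  "scaled_proxy \<theta> x0 R x = R\<^sup>2 * \<theta> ((x - x0) /\<^sub>R R)"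

definition scaled_proxy_grad ::
    "('e::euclidean_space \<Rightarrow> 'e \<Rightarrow>\<^sub>L real) \<Rightarrow> 'e \<Rightarrow> real \<Rightarrow> 'e \<Rightarrow> 'e \<Rightarrow>\<^sub>L real" where
  "scaled_proxy_grad \<theta>' x0 R x = R *\<^sub>R \<theta>' ((x - x0) /\<^sub>R R)"

definition bregman ::
    "('e::euclidean_space \<Rightarrow> real) \<Rightarrow> ('e \<Rightarrow> 'e \<Rightarrow>\<^sub>L real) \<Rightarrow> 'e \<Rightarrow> 'e \<Rightarrow> real" where
  "bregman v v' x z = v z - v x - v' x (z - x)"

text \<open>
  In \<open>prox X \<psi> V \<beta> x \<xi>\<close> the minimizer exists and is unique in the situations considered, by
  compactness of \<open>X\<close> and strong convexity of \<open>V x\<close>.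
\<close>

definition prox ::
    "'e::euclidean_space set \<Rightarrow> ('e \<Rightarrow> real) \<Rightarrow> ('e \<Rightarrow> 'e \<Rightarrow> real) \<Rightarrow> real \<Rightarrow> 'e \<Rightarrow> ('e \<Rightarrow>\<^sub>L real) \<Rightarrow> 'e" where
  "prox X \<psi> V \<beta> x \<xi> = arg_min_on (\<lambda>z. \<xi> z + \<psi> z + \<beta> * V x z) X"

definition truncated_oracle ::
    "('e::euclidean_space \<Rightarrow> real) \<Rightarrow> real \<Rightarrow> ('e \<Rightarrow> 'w \<Rightarrow> 'e \<Rightarrow>\<^sub>L real) \<Rightarrow> real \<Rightarrow>
     'e \<Rightarrow> ('e \<Rightarrow>\<^sub>L real) \<Rightarrow> real \<Rightarrow> real \<Rightarrow> 'e \<Rightarrow> 'w \<Rightarrow> 'e \<Rightarrow>\<^sub>L real" where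
  "truncated_oracle nrm L G \<sigma> xbar gbar \<upsilon> lam x w =
     (if dual_norm nrm (G x w - gbar) \<le> L * nrm (xbar - x) + lam + \<upsilon> * \<sigma> then G x w else gbar)"

primrec rsmd_iter ::
    "'e::euclidean_space set \<Rightarrow> ('e \<Rightarrow> real) \<Rightarrow> ('e \<Rightarrow> 'e \<Rightarrow> real) \<Rightarrow> (nat \<Rightarrow> real) \<Rightarrow>
     ('e \<Rightarrow> 'w \<Rightarrow> 'e \<Rightarrow>\<^sub>L real) \<Rightarrow> 'e \<Rightarrow> (nat \<Rightarrow> 'w) \<Rightarrow> nat \<Rightarrow> 'e" where
  "rsmd_iter X \<psi> V \<beta> Y x0 \<omega> 0 = x0"
| "rsmd_iter X \<psi> V \<beta> Y x0 \<omega> (Suc i) =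
     prox X \<psi> V (\<beta> i) (rsmd_iter X \<psi> V \<beta> Y x0 \<omega> i)
       (Y (rsmd_iter X \<psi> V \<beta> Y x0 \<omega> i) (\<omega> (Suc i)))"

definition weighted_average :: "(nat \<Rightarrow> real) \<Rightarrow> nat \<Rightarrow> (nat \<Rightarrow> 'e::real_vector) \<Rightarrow> 'e" where
  "weighted_average \<beta> N x =
     inverse (\<Sum>i=1..N. inverse (\<beta> (i - 1))) *\<^sub>R (\<Sum>i=1..N. inverse (\<beta> (i - 1)) *\<^sub>R x i)"

definition gap ::
    "('e::euclidean_space \<Rightarrow> 'e \<Rightarrow>\<^sub>L real) \<Rightarrow> ('e \<Rightarrow> real) \<Rightarrow> ('e \<Rightarrow> 'e \<Rightarrow> real) \<Rightarrow> (nat \<Rightarrow> real) \<Rightarrow>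
     nat \<Rightarrow> (nat \<Rightarrow> 'e) \<Rightarrow> 'e \<Rightarrow> real" where
  "gap d\<phi> \<psi> V \<beta> N x z =
     (\<Sum>i=1..N. (inverse (\<beta> (i - 1)) * (d\<phi> (x (i - 1)) (x i - z) + \<psi> (x i) - \<psi> z)
        + V (x (i - 1)) (x i) / 2))"

text \<open>
  An existential quantifier over constants cannot be placed outside the quantification over the
  types of $E$ and $\Omega$, so on its own it would let the constants depend on these types, in
  particular on the dimension of $E$. A numerical upper bound that is the same for all types
  excludes this. Its value is immaterial; it leaves a wide margin.
\<close>

definition absolute_constant :: "real \<Rightarrow> bool" where
  "absolute_constant c \<longleftrightarrow> 0 < c \<and> c \<le> 10 ^ 6"

end

theory Submission
  imports Defs
begin

text \<open>
The proof has a deterministic and a probabilistic half, which meet in the noise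
\<open>\<xi>\<^sub>i = y\<^sub>i - \<nabla>\<phi>(x\<^sub>i\<^sub>-\<^sub>1)\<close> of the truncated oracle.

Deterministic half. Convexity of \<open>\<phi>\<close>, the descent inequality and \<open>V\<^sub>x(z) \<ge> \<parallel>z - x\<parallel>\<^sup>2 / 2\<close> bound
\<open>F(x\<^sub>i) - F(z)\<close> by \<open>\<beta>\<close> times the \<open>i\<close>-th term of \<open>\<epsilon>(x\<^sup>N, z)\<close>; averaging gives the first inequality
(\<open>optimality_gap_le\<close>). The three-point inequality of the prox step (\<open>prox_three_point\<close>) makes the
Bregman terms telescope and leaves the noise: quadratic terms \<open>\<parallel>\<xi>\<^sub>i\<parallel>\<^sup>2\<close> and linear terms
\<open>\<langle>\<xi>\<^sub>i, z - x\<^sub>i\<^sub>-\<^sub>1\<rangle>\<close>. The latter depend on the comparison point \<open>z\<close>, over which a supremum is taken. A second,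
fictitious mirror descent run \<open>z\<^sub>i\<close>, fed with the losses \<open>-\<xi>\<^sub>i\<close>, removes this dependence: its
regret bound replaces \<open>z\<close> by \<open>z\<^sub>i\<^sub>-\<^sub>1\<close> at the price of one more \<open>V\<^sub>x\<^sub>0(z) \<le> R\<^sup>2\<Theta>\<close> and of further terms
\<open>\<parallel>\<xi>\<^sub>i\<parallel>\<^sup>2\<close>. The outcome is \<open>gap_le\<close>, in which only \<open>\<Sum>\<langle>\<xi>\<^sub>i, z\<^sub>i\<^sub>-\<^sub>1 - x\<^sub>i\<^sub>-\<^sub>1\<rangle>\<close> and \<open>\<Sum>\<parallel>\<xi>\<^sub>i\<parallel>\<^sup>2\<close> are random.

Probabilistic half. Truncation makes the noise bounded by a multiple of
\<open>\<Lambda> = max {\<sigma> \<surd>(N / \<tau>), M}\<close>, while its second moment stays below \<open>4 \<sigma>\<^sup>2\<close> and the bias that it causes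
is at most \<open>3 \<sigma>\<^sup>2 / \<lambda>\<close>, because a rejection forces a deviation of \<open>G\<close> larger than \<open>\<lambda>\<close>. The points
\<open>x\<^sub>i\<^sub>-\<^sub>1\<close> and \<open>z\<^sub>i\<^sub>-\<^sub>1\<close> depend only on \<open>\<omega>\<^sub>1, \<dots>, \<omega>\<^sub>i\<^sub>-\<^sub>1\<close>, so Fubini and induction bound the exponential moment
of either sum, and Markov's inequality gives a Bernstein-type tail (\<open>adapted_sum_tail\<close>). With
exponent \<open>1/b\<close>, where \<open>b\<close> bounds a summand, both deviations have the order claimed, for exactly this \<open>\<lambda>\<close>; each
fails with probability at most \<open>e\<^sup>-\<^sup>\<tau>\<close>.

One point needs care: the selection \<open>\<theta>'\<close> exists only where \<open>\<partial>\<theta>\<close> is nonempty, and the feasible set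
may touch the boundary of the ball. That a prox step always lands where \<open>\<theta>'\<close> is defined follows by
separating convex sets (\<open>minimizer_in_subdiff_domain\<close>), and that the optimality condition holds with the
selected subgradient, not just with some subgradient, follows from continuity of the selection
(\<open>minimizer_variational_inequality\<close>).
\<close>

section \<open>An arbitrary norm on a finite-dimensional space and its dual\<close>

locale finite_dim_norm =
  fixes nrm :: "'e::euclidean_space \<Rightarrow> real"
  assumes is_norm_nrm: "is_norm nrm"
begin

lemma nrm_nonneg [simp]: "0 \<le> nrm x"
  and nrm_eq_0_iff [simp]: "nrm x = 0 \<longleftrightarrow> x = 0"
  and nrm_scaleR: "nrm (a *\<^sub>R x) = \<bar>a\<bar> * nrm x"
  and nrm_triangle: "nrm (x + y) \<le> nrm x + nrm y"
  using is_norm_nrm by (simp_all add: is_norm_def)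

lemma nrm_minus [simp]: "nrm (- x) = nrm x"
  using nrm_scaleR[of "-1" x] by simp

lemma nrm_minus_commute: "nrm (x - y) = nrm (y - x)"
  using nrm_minus[of "x - y"] by simp

lemma nrm_zero [simp]: "nrm 0 = 0"
  by simp

lemma continuous_on_nrm: "continuous_on A nrm"
proof -
  have "convex_on UNIV nrm"
    by (intro convex_onI) (auto simp: nrm_scaleR intro!: order_trans[OF nrm_triangle])
  then have "continuous_on UNIV nrm"
    by (rule convex_on_continuous[OF open_UNIV])
  then show ?thesis
    by (rule continuous_on_subset) simp
qed

text \<open>
By compactness of the Euclidean unit sphere, the norm is bounded away from zero there, and scaling does
the rest. Equivalence of the two norms is what connects \<open>nrm\<close> to topology, Borel sets and derivatives.
\<close>

lemma nrm_dominates_norm: "\<exists>m>0. \<forall>x. norm x \<le> m * nrm x"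
proof -
  have "sphere (0 :: 'e) 1 \<noteq> {}" by simp
  then obtain u where u: "u \<in> sphere 0 1" "\<And>y. y \<in> sphere 0 1 \<Longrightarrow> nrm u \<le> nrm y"
    using continuous_attains_inf[OF compact_sphere _ continuous_on_nrm] by blast
  from u(1) have u0: "0 < nrm u"
    using nrm_nonneg[of u] nrm_eq_0_iff[of u] by (metis dist_0_norm mem_sphere norm_zero order_le_less zero_neq_one)
  have "norm x \<le> inverse (nrm u) * nrm x" for x
  proof (cases "x = 0")
    case False
    then have "nrm u \<le> nrm (x /\<^sub>R norm x)" by (intro u(2)) simp
    also have "\<dots> = nrm x / norm x" by (simp add: nrm_scaleR divide_inverse mult.commute)
    finally show ?thesis using False u0 by (simp add: field_simps)
  qed simp
  then show ?thesis using u0 by (intro exI[of _ "inverse (nrm u)"]) simp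
qed

lemma norm_dominates_nrm: "\<exists>m>0. \<forall>x. nrm x \<le> m * norm x"
proof -
  have "bounded (nrm ` cball 0 1)"
    by (intro compact_imp_bounded compact_continuous_image continuous_on_nrm compact_cball)
  then obtain m where m: "0 < m" "\<And>x. norm x \<le> 1 \<Longrightarrow> nrm x \<le> m"
    unfolding bounded_pos by auto
  have "nrm x \<le> m * norm x" for x
  proof (cases "x = 0")
    case False
    then have "nrm (x /\<^sub>R norm x) \<le> m" by (intro m(2)) simp
    then show ?thesis using False by (simp add: nrm_scaleR field_simps)
  qed simp
  then show ?thesis using m(1) by blast
qed

lemma compact_unit_ball: "compact (unit_ball nrm)"
proof -
  obtain m where m: "0 < m" "\<And>x. norm x \<le> m * nrm x" using nrm_dominates_norm by blast
  have "norm x \<le> m" if "x \<in> unit_ball nrm" for x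
    using order_trans[OF m(2)[of x] mult_left_le[of "nrm x" m]] that m(1) by (simp add: unit_ball_def)
  then have "bounded (unit_ball nrm)" by (auto simp: bounded_iff)
  moreover have "closed (unit_ball nrm)"
    unfolding unit_ball_def by (intro closed_Collect_le continuous_on_nrm continuous_on_const)
  ultimately show ?thesis by (simp add: compact_eq_bounded_closed)
qed

lemma convex_unit_ball: "convex (unit_ball nrm)"
proof (rule convexI)
  fix x y :: 'e and a b :: real
  assume *: "x \<in> unit_ball nrm" "y \<in> unit_ball nrm" "0 \<le> a" "0 \<le> b" "a + b = 1"
  have "nrm (a *\<^sub>R x + b *\<^sub>R y) \<le> a * nrm x + b * nrm y"
    using nrm_triangle[of "a *\<^sub>R x" "b *\<^sub>R y"] * by (simp add: nrm_scaleR)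
  also have "\<dots> \<le> 1" using * by (intro convex_bound_le) (auto simp: unit_ball_def)
  finally show "a *\<^sub>R x + b *\<^sub>R y \<in> unit_ball nrm" by (simp add: unit_ball_def)
qed

lemma zero_in_unit_ball [simp]: "0 \<in> unit_ball nrm"
  by (simp add: unit_ball_def)

lemma bdd_above_functional_unit_ball: "bdd_above ((s :: 'e \<Rightarrow>\<^sub>L real) ` unit_ball nrm)"
  by (intro bounded_imp_bdd_above compact_imp_bounded compact_continuous_image compact_unit_ball
      linear_continuous_on blinfun.bounded_linear_right)

lemma apply_le_dual_norm: "blinfun_apply s x \<le> dual_norm nrm s * nrm x"
proof (cases "x = 0")
  case False
  then have "nrm x > 0" using nrm_nonneg[of x] nrm_eq_0_iff[of x] by linarith
  have "x /\<^sub>R nrm x \<in> unit_ball nrm" using \<open>nrm x > 0\<close> by (simp add: unit_ball_def nrm_scaleR field_simps)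
  then have "s (x /\<^sub>R nrm x) \<le> dual_norm nrm s"
    unfolding dual_norm_def by (intro cSUP_upper bdd_above_functional_unit_ball)
  then show ?thesis using \<open>nrm x > 0\<close> by (simp add: blinfun.scaleR_right field_simps)
qed (simp add: blinfun.zero_right)

lemma dual_norm_least: "(\<And>x. x \<in> unit_ball nrm \<Longrightarrow> blinfun_apply s x \<le> c) \<Longrightarrow> dual_norm nrm s \<le> c"
  unfolding dual_norm_def by (intro cSUP_least) (use zero_in_unit_ball in blast)+

lemma dual_norm_nonneg [simp]: "0 \<le> dual_norm nrm s"
  unfolding dual_norm_def
  by (rule cSUP_upper2[OF bdd_above_functional_unit_ball, of 0]) (simp_all add: blinfun.zero_right)

lemma abs_apply_le_dual_norm: "\<bar>blinfun_apply s x\<bar> \<le> dual_norm nrm s * nrm x"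
  using apply_le_dual_norm[of s x] apply_le_dual_norm[of s "- x"] by (simp add: blinfun.minus_right)

lemma dual_norm_triangle: "dual_norm nrm (s + t) \<le> dual_norm nrm s + dual_norm nrm t"
proof (rule dual_norm_least)
  fix x assume x: "x \<in> unit_ball nrm"
  have "s x \<le> dual_norm nrm s" "t x \<le> dual_norm nrm t"
    using x unfolding dual_norm_def by (auto intro!: cSUP_upper bdd_above_functional_unit_ball)
  then show "(s + t) x \<le> dual_norm nrm s + dual_norm nrm t" by (simp add: blinfun.add_left)
qed

lemma dual_norm_minus [simp]: "dual_norm nrm (- s) = dual_norm nrm s"
proof -
  have "dual_norm nrm (- s) \<le> dual_norm nrm s" for s :: "'e \<Rightarrow>\<^sub>L real"
  proof (rule dual_norm_least)
    fix x assume "x \<in> unit_ball nrm"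
    then have "- x \<in> unit_ball nrm" by (simp add: unit_ball_def)
    then have "s (- x) \<le> dual_norm nrm s"
      unfolding dual_norm_def by (intro cSUP_upper bdd_above_functional_unit_ball)
    then show "(- s) x \<le> dual_norm nrm s" by (simp add: blinfun.minus_left blinfun.minus_right)
  qed
  from this[of s] this[of "- s"] show ?thesis by simp
qed

lemma dual_norm_minus_commute: "dual_norm nrm (s - t) = dual_norm nrm (t - s)"
  using dual_norm_minus[of "s - t"] by simp

lemma dual_norm_le_norm: "\<exists>m>0. \<forall>s. dual_norm nrm s \<le> m * norm s"
proof -
  obtain m where m: "0 < m" "\<And>x. norm x \<le> m * nrm x" using nrm_dominates_norm by blast
  have "dual_norm nrm s \<le> m * norm s" for s
  proof (rule dual_norm_least)
    fix x assume x: "x \<in> unit_ball nrm"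
    have "norm x \<le> m" using order_trans[OF m(2)[of x] mult_left_le[of "nrm x" m]] x m(1)
      by (simp add: unit_ball_def)
    have "s x \<le> norm s * norm x" using norm_blinfun[of s x] by simp
    also have "\<dots> \<le> norm s * m" using \<open>norm x \<le> m\<close> by (intro mult_left_mono) auto
    finally show "s x \<le> m * norm s" by (simp add: mult.commute)
  qed
  then show ?thesis using m(1) by blast
qed

lemma norm_le_dual_norm: "\<exists>m>0. \<forall>s. norm s \<le> m * dual_norm nrm s"
proof -
  obtain m where m: "0 < m" "\<And>x. nrm x \<le> m * norm x" using norm_dominates_nrm by blast
  have "norm s \<le> m * dual_norm nrm s" for s
  proof (rule norm_blinfun_bound)
    fix x :: 'e
    have "dual_norm nrm s * nrm x \<le> dual_norm nrm s * (m * norm x)"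
      by (intro mult_left_mono m(2)) auto
    then show "norm (s x) \<le> m * dual_norm nrm s * norm x"
      using abs_apply_le_dual_norm[of s x] by (simp add: mult_ac)
  qed (use m(1) in auto)
  then show ?thesis using m(1) by blast
qed

lemma continuous_on_dual_norm: "continuous_on A (dual_norm nrm)"
proof -
  obtain m where m: "0 < m" "\<And>s. dual_norm nrm s \<le> m * norm s" using dual_norm_le_norm by blast
  have "m-lipschitz_on A (dual_norm nrm)"
  proof (rule lipschitz_onI)
    fix s t :: "'e \<Rightarrow>\<^sub>L real"
    have "dual_norm nrm s \<le> dual_norm nrm (s - t) + dual_norm nrm t"
      using dual_norm_triangle[of "s - t" t] by simp
    moreover have "dual_norm nrm t \<le> dual_norm nrm (s - t) + dual_norm nrm s"
      using dual_norm_triangle[of "t - s" s] dual_norm_minus_commute[of s t] by simp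
    ultimately show "dist (dual_norm nrm s) (dual_norm nrm t) \<le> m * dist s t"
      using m(2)[of "s - t"] by (simp add: dist_real_def dist_norm)
  qed (use m in auto)
  then show ?thesis by (rule lipschitz_on_continuous_on)
qed

lemma borel_measurable_dual_norm [measurable]: "dual_norm nrm \<in> borel_measurable borel"
  by (intro borel_measurable_continuous_onI continuous_on_dual_norm)

end

section \<open>Convex analysis of the mirror step\<close>

lemma nonneg_at_0_if_nonneg_after:
  fixes f :: "real \<Rightarrow> real"
  assumes "continuous_on {0..1} f" "\<And>t. 0 < t \<Longrightarrow> t \<le> 1 \<Longrightarrow> 0 \<le> f t"
  shows "0 \<le> f 0"
proof -
  have cl: "closure {0<..1::real} = {0..1}" by simp
  show ?thesis
    using assms by (intro continuous_ge_on_closure[of "{0<..1}" f 0 0]) (simp_all add: cl)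
qed

text \<open>
An integrated form of a bound on slopes that needs no derivative: on a uniform partition the
increments add up to a Riemann sum of \<open>A + B t\<close>. It serves for the quadratic upper bound of a
function with Lipschitz gradient and, reversed, for the quadratic lower bound of a strongly convex one.
\<close>

lemma increment_le_of_linear_rate:
  fixes g :: "real \<Rightarrow> real"
  assumes rate: "\<And>a b. 0 \<le> a \<Longrightarrow> a < b \<Longrightarrow> b \<le> 1 \<Longrightarrow> g b - g a \<le> (b - a) * (A + B * b)"
  shows "g 1 - g 0 \<le> A + B / 2"
proof (rule LIMSEQ_le_const)
  show "(\<lambda>n. A + B / 2 * (1 + inverse (real (Suc n)))) \<longlonglongrightarrow> A + B / 2"
    by (rule tendsto_eq_intros LIMSEQ_inverse_real_of_nat refl | simp)+
  have "g 1 - g 0 \<le> A + B / 2 * (1 + inverse (real n))" if n: "0 < n" for n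
  proof -
    have "g 1 - g 0 = (\<Sum>k<n. g (real (Suc k) / real n) - g (real k / real n))"
      using n by (subst sum_lessThan_telescope) simp
    also have "\<dots> \<le> (\<Sum>k<n. (real (Suc k) / real n - real k / real n) * (A + B * (real (Suc k) / real n)))"
      using n by (intro sum_mono rate) (auto simp: divide_simps)
    also have "\<dots> = (\<Sum>k<n. A / real n + B / (real n)\<^sup>2 * real (Suc k))"
      using n by (intro sum.cong refl) (simp add: field_simps power2_eq_square)
    also have "\<dots> = A + B / (real n)\<^sup>2 * (\<Sum>k<n. real (Suc k))"
      using n by (simp add: sum.distrib sum_distrib_left del: of_nat_Suc)
    also have "(\<Sum>k<n. real (Suc k)) = real n * (real n + 1) / 2"
      by (induction n) (simp_all add: field_simps)
    also have "A + B / (real n)\<^sup>2 * \<dots> = A + B / 2 * (1 + inverse (real n))"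
      using n by (simp add: field_simps power2_eq_square)
    finally show ?thesis .
  qed
  then show "\<exists>N. \<forall>n\<ge>N. g 1 - g 0 \<le> A + B / 2 * (1 + inverse (real (Suc n)))"
    by blast
qed

lemma increment_ge_of_linear_rate:
  fixes g :: "real \<Rightarrow> real"
  assumes rate: "\<And>a b. 0 \<le> a \<Longrightarrow> a < b \<Longrightarrow> b \<le> 1 \<Longrightarrow> (b - a) * (A + B * a) \<le> g b - g a"
  shows "A + B / 2 \<le> g 1 - g 0"
proof -
  have "g (1 - 1) - g (1 - 0) \<le> (- A - B) + B / 2"
  proof (rule increment_le_of_linear_rate)
    fix a b :: real assume "0 \<le> a" "a < b" "b \<le> 1"
    then show "g (1 - b) - g (1 - a) \<le> (b - a) * (- A - B + B * b)"
      using rate[of "1 - b" "1 - a"] by (simp add: algebra_simps)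
  qed
  then show ?thesis by simp
qed

text \<open>
This is the sum rule for subdifferentials in the only form needed. If \<open>z\<close> minimizes \<open>v + h\<close>, the strict
epigraph of \<open>v - v z\<close> and the hypograph of \<open>h z - h\<close> are disjoint, and the slope of a separating
hyperplane is a subgradient of \<open>v\<close> at \<open>z\<close>. The hyperplane is not vertical, since a vertical one would separate
\<open>X\<close> from \<open>D\<close> although \<open>X\<close> meets the interior of \<open>D\<close>.
\<close>

lemma minimizer_in_subdiff_domain:
  fixes v h :: "'e::euclidean_space \<Rightarrow> real"
  assumes v: "convex_on D v" and h: "convex_on X h" and "X \<subseteq> D"
    and w: "w \<in> X" "w \<in> interior D" and z: "z \<in> X"
    and min: "\<And>u. u \<in> X \<Longrightarrow> v z + h z \<le> v u + h u"
  shows "z \<in> subdiff_domain v D"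
proof -
  define S where "S = {p. fst p \<in> D \<and> v (fst p) - v z < snd p}"
  define T where "T = {p. fst p \<in> X \<and> snd p \<le> h z - h (fst p)}"
  have D: "convex D" and X: "convex X" using v h by (auto simp: convex_on_def)
  have "convex S"
  proof (rule convexI)
    fix p q :: "'e \<times> real" and a b :: real
    assume *: "p \<in> S" "q \<in> S" "0 \<le> a" "0 \<le> b" "a + b = 1"
    have "v (a *\<^sub>R fst p + b *\<^sub>R fst q) - v z \<le> a * (v (fst p) - v z) + b * (v (fst q) - v z)"
    proof -
      have "v (a *\<^sub>R fst p + b *\<^sub>R fst q) \<le> a * v (fst p) + b * v (fst q)"
        using v * unfolding convex_on_def S_def by blast
      moreover have "a * v z + b * v z = v z"
        using * by (simp flip: distrib_right)
      ultimately show ?thesis by (simp add: right_diff_distrib)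
    qed
    also have "\<dots> < a * snd p + b * snd q"
    proof (cases "a = 0")
      case False
      then show ?thesis using * by (intro add_less_le_mono mult_strict_left_mono mult_left_mono) (auto simp: S_def)
    qed (use * in \<open>auto simp: S_def\<close>)
    finally show "a *\<^sub>R p + b *\<^sub>R q \<in> S"
      using * D by (auto simp: S_def convex_def)
  qed
  moreover have "convex T"
  proof (rule convexI)
    fix p q :: "'e \<times> real" and a b :: real
    assume *: "p \<in> T" "q \<in> T" "0 \<le> a" "0 \<le> b" "a + b = 1"
    have "a * snd p + b * snd q \<le> a * (h z - h (fst p)) + b * (h z - h (fst q))"
      using * by (intro add_mono mult_left_mono) (auto simp: T_def)
    also have "\<dots> = h z - (a * h (fst p) + b * h (fst q))"
    proof -
      have "a * h z + b * h z = h z" using * by (simp flip: distrib_right)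
      then show ?thesis by (simp add: right_diff_distrib)
    qed
    also have "\<dots> \<le> h z - h (a *\<^sub>R fst p + b *\<^sub>R fst q)"
    proof -
      have "h (a *\<^sub>R fst p + b *\<^sub>R fst q) \<le> a * h (fst p) + b * h (fst q)"
        using h * unfolding convex_on_def T_def by blast
      then show ?thesis by simp
    qed
    finally show "a *\<^sub>R p + b *\<^sub>R q \<in> T"
      using * X by (auto simp: T_def convex_def)
  qed
  moreover have "(z, 1) \<in> S" using z \<open>X \<subseteq> D\<close> by (auto simp: S_def)
  moreover have zT: "(z, 0) \<in> T" using z by (auto simp: T_def)
  moreover have "S \<inter> T = {}"
    using min by (fastforce simp: S_def T_def)
  ultimately obtain ac b where ac: "ac \<noteq> 0" "\<forall>p\<in>S. inner ac p \<le> b" "\<forall>p\<in>T. b \<le> inner ac p"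
    using separating_hyperplane_sets[of S T] by blast
  define a c where "a = fst ac" and "c = snd ac"
  have sepS: "a \<bullet> u + c * r \<le> b" if "u \<in> D" "v u - v z < r" for u r
    using ac(2) that by (force simp: S_def a_def c_def inner_prod_def)
  have sepT: "b \<le> a \<bullet> u + c * r" if "u \<in> X" "r \<le> h z - h u" for u r
    using ac(3) that by (force simp: T_def a_def c_def inner_prod_def)
  have b: "b \<le> a \<bullet> z" using sepT[of z 0] z by simp
  have "c \<le> 0" using sepS[of z 1] z b \<open>X \<subseteq> D\<close> by auto
  have limit: "a \<bullet> u + c * (v u - v z) \<le> a \<bullet> z" if u: "u \<in> D" for u
  proof (rule field_le_epsilon)
    fix e :: real assume "0 < e"
    define d where "d = e / (1 + \<bar>c\<bar>)"
    have "0 < d" using \<open>0 < e\<close> by (simp add: d_def)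
    have "\<bar>c\<bar> * d \<le> e" using \<open>0 < e\<close> by (simp add: d_def field_simps)
    then show "a \<bullet> u + c * (v u - v z) \<le> a \<bullet> z + e"
      using sepS[of u "v u - v z + d"] b \<open>0 < d\<close> \<open>c \<le> 0\<close> u by (simp add: algebra_simps)
  qed
  \<comment> \<open>a vertical hyperplane would support \<open>D\<close> at its interior point \<open>w\<close>\<close>
  have "c \<noteq> 0"
  proof
    assume "c = 0"
    have "a \<bullet> z \<le> a \<bullet> w"
    proof -
      have "a \<bullet> z \<le> b"
      proof (rule field_le_epsilon)
        fix e :: real assume "0 < e"
        show "a \<bullet> z \<le> b + e" using sepS[of z e] z \<open>X \<subseteq> D\<close> \<open>0 < e\<close> \<open>c = 0\<close> by auto
      qed
      then show ?thesis using sepT[of w "h z - h w"] w \<open>c = 0\<close> by simp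
    qed
    obtain e where e: "0 < e" "cball w e \<subseteq> D"
      using w(2) unfolding mem_interior_cball by blast
    have "a \<noteq> 0" using ac(1) \<open>c = 0\<close> by (auto simp: a_def c_def prod_eq_iff)
    then have "w + (e / norm a) *\<^sub>R a \<in> cball w e" using e(1) by (simp add: dist_norm)
    then have "a \<bullet> (w + (e / norm a) *\<^sub>R a) \<le> a \<bullet> z" using limit e(2) \<open>c = 0\<close> by auto
    then have "e / norm a * (a \<bullet> a) \<le> 0" using \<open>a \<bullet> z \<le> a \<bullet> w\<close> by (simp add: inner_add_right)
    moreover have "0 < e / norm a * (a \<bullet> a)" using e(1) \<open>a \<noteq> 0\<close> by simp
    ultimately show False by linarith
  qed
  with \<open>c \<le> 0\<close> have "c < 0" by simp
  have "v z + blinfun_inner_right (- (1 / c) *\<^sub>R a) (u - z) \<le> v u" if "u \<in> D" for u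
    using limit[OF that] \<open>c < 0\<close> by (simp add: inner_diff_right field_simps)
  then have "blinfun_inner_right (- (1 / c) *\<^sub>R a) \<in> subdifferential v D z"
    by (simp add: subdifferential_def)
  then show ?thesis using z \<open>X \<subseteq> D\<close> by (auto simp: subdiff_domain_def)
qed

text \<open>
An interior point \<open>x\<close> minimizes \<open>v\<close> over \<open>{x}\<close>, so the previous lemma applies.
\<close>

lemma interior_subset_subdiff_domain:
  assumes "convex_on D v"
  shows "interior D \<subseteq> subdiff_domain v D"
proof
  fix x assume x: "x \<in> interior D"
  have "convex_on {x} (\<lambda>_. 0)" by (simp add: convex_on_def)
  then show "x \<in> subdiff_domain v D"
    by (rule minimizer_in_subdiff_domain[OF assms]) (use x interior_subset in auto)
qed

lemma young_inequality:
  fixes a b c :: real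
  assumes "0 < c"
  shows "a * b \<le> a\<^sup>2 / (2 * c) + c * (b\<^sup>2 / 2)"
proof -
  have "0 \<le> (a - c * b)\<^sup>2 / (2 * c)" using assms by simp
  also have "\<dots> = a\<^sup>2 / (2 * c) + c * (b\<^sup>2 / 2) - a * b"
    using assms by (simp add: power2_diff field_simps power2_eq_square)
  finally show ?thesis by simp
qed

text \<open>
The distance-generating function \<open>v\<close> lives on a convex set \<open>D\<close>, and the feasible set \<open>X\<close> may reach
the boundary of \<open>D\<close>, where \<open>v\<close> can fail to have subgradients.
\<close>

locale mirror_setup = finite_dim_norm nrm
  for nrm :: "'e::euclidean_space \<Rightarrow> real" +
  fixes D :: "'e set"
    and v :: "'e \<Rightarrow> real"
    and v' :: "'e \<Rightarrow> 'e \<Rightarrow>\<^sub>L real"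
    and X :: "'e set"
  assumes v_continuous: "continuous_on D v"
    and v_convex: "convex_on D v"
    and v'_subgradient: "\<And>x. x \<in> subdiff_domain v D \<Longrightarrow> v' x \<in> subdifferential v D x"
    and v'_continuous: "continuous_on (subdiff_domain v D) v'"
    and v'_strongly_monotone:
      "\<And>x y. x \<in> subdiff_domain v D \<Longrightarrow> y \<in> subdiff_domain v D \<Longrightarrow>
         (nrm (x - y))\<^sup>2 \<le> (v' x - v' y) (x - y)"
    and X_convex: "convex X"
    and X_compact: "compact X"
    and X_subset: "X \<subseteq> D"
    and X_meets_interior: "X \<inter> interior D \<noteq> {}"
begin

abbreviation (input) V :: "'e \<Rightarrow> 'e \<Rightarrow> real" where
  "V \<equiv> bregman v v'"

abbreviation (input) Dom :: "'e set" where
  "Dom \<equiv> subdiff_domain v D"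

lemma subgradient_ineq: "x \<in> Dom \<Longrightarrow> z \<in> D \<Longrightarrow> v x + v' x (z - x) \<le> v z"
  using v'_subgradient[of x] by (simp add: subdifferential_def)

lemma Dom_subset: "Dom \<subseteq> D"
  by (auto simp: subdiff_domain_def)

lemma convex_D: "convex D"
  using v_convex by (simp add: convex_on_def)

lemma shrink_to_interior:
  assumes "x \<in> D" "w \<in> interior D" "0 < t" "t \<le> 1"
  shows "x + t *\<^sub>R (w - x) \<in> interior D"
  using mem_interior_convex_shrink[OF convex_D assms(2,1,3,4)]
  by (simp add: algebra_simps)

lemma segment_in_X:
  assumes "x \<in> X" "y \<in> X" "0 \<le> t" "t \<le> 1"
  shows "x + t *\<^sub>R (y - x) \<in> X"
  using convexD_alt[OF X_convex assms] by (simp add: algebra_simps)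

text \<open>
All points of the segment from \<open>x\<close> to an interior point \<open>z\<close>, apart from \<open>x\<close>, are interior, so \<open>v'\<close> is
defined along it; strong monotonicity makes the slope of \<open>v\<close> grow at rate at least \<open>\<parallel>z - x\<parallel>\<^sup>2\<close>.
\<close>

lemma bregman_ge_interior:
  assumes x: "x \<in> Dom" and z: "z \<in> interior D"
  shows "(nrm (z - x))\<^sup>2 / 2 \<le> V x z"
proof -
  define p where "p t = x + t *\<^sub>R (z - x)" for t
  have xD: "x \<in> D" using x Dom_subset by auto
  have pint: "p t \<in> interior D" if "0 < t" "t \<le> 1" for t
    using shrink_to_interior[OF xD z that] by (simp add: p_def)
  have pDom: "p t \<in> Dom" if "0 \<le> t" "t \<le> 1" for t
  proof (cases "t = 0")
    case True then show ?thesis using x by (simp add: p_def)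
  next
    case False
    then show ?thesis using pint[of t] that interior_subset_subdiff_domain[OF v_convex] by auto
  qed
  have "v' x (z - x) + (nrm (z - x))\<^sup>2 / 2 \<le> v (p 1) - v (p 0)"
  proof (rule increment_ge_of_linear_rate)
    fix a b :: real assume ab: "0 \<le> a" "a < b" "b \<le> 1"
    have "v' x (z - x) + (nrm (z - x))\<^sup>2 * a \<le> v' (p a) (z - x)"
    proof (cases "a = 0")
      case False
      have "(nrm (p a - x))\<^sup>2 \<le> (v' (p a) - v' x) (p a - x)"
        using pDom[of a] x ab by (intro v'_strongly_monotone) auto
      then have "a * (a * (nrm (z - x))\<^sup>2) \<le> a * (v' (p a) (z - x) - v' x (z - x))"
        by (simp add: p_def nrm_scaleR blinfun.diff_left blinfun.scaleR_right power_mult_distrib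
            power2_eq_square mult_ac right_diff_distrib)
      then show ?thesis using False ab by (simp add: mult.commute)
    qed (simp add: p_def)
    then have "(b - a) * (v' x (z - x) + (nrm (z - x))\<^sup>2 * a) \<le> (b - a) * v' (p a) (z - x)"
      using ab by (intro mult_left_mono) auto
    also have "\<dots> = v' (p a) (p b - p a)"
      by (simp add: p_def blinfun.scaleR_right flip: scaleR_diff_left)
    also have "\<dots> \<le> v (p b) - v (p a)"
      using subgradient_ineq[of "p a" "p b"] pDom[of a] pDom[of b] Dom_subset ab by auto
    finally show "(b - a) * (v' x (z - x) + (nrm (z - x))\<^sup>2 * a) \<le> v (p b) - v (p a)" .
  qed
  then show ?thesis by (simp add: p_def bregman_def)
qed

lemma continuous_on_bregman: "continuous_on D (V x)"
  unfolding bregman_def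
  by (intro continuous_intros v_continuous)

text \<open>
Boundary points \<open>z\<close> are limits of interior ones, and the Bregman distance is continuous in \<open>z\<close>, up to
the boundary.
\<close>

lemma bregman_ge:
  assumes x: "x \<in> Dom" and z: "z \<in> D"
  shows "(nrm (z - x))\<^sup>2 / 2 \<le> V x z"
proof -
  obtain w where w: "w \<in> interior D" using X_meets_interior by auto
  define p where "p t = z + t *\<^sub>R (w - z)" for t
  have pD: "p t \<in> D" if "0 \<le> t" "t \<le> 1" for t
    using convexD_alt[OF convex_D z _ that, of w] w interior_subset
    by (auto simp: p_def algebra_simps)
  have p: "continuous_on {0..1} p" unfolding p_def by (intro continuous_intros)
  have "0 \<le> V x (p 0) - (nrm (p 0 - x))\<^sup>2 / 2"
  proof (rule nonneg_at_0_if_nonneg_after)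
    show "continuous_on {0..1} (\<lambda>t. V x (p t) - (nrm (p t - x))\<^sup>2 / 2)"
      using pD p
      by (intro continuous_intros continuous_on_compose2[OF continuous_on_bregman]
          continuous_on_compose2[OF continuous_on_nrm[of UNIV]]) auto
    show "0 \<le> V x (p t) - (nrm (p t - x))\<^sup>2 / 2" if "0 < t" "t \<le> 1" for t
      using bregman_ge_interior[OF x shrink_to_interior[OF z w that]] by (simp add: p_def)
  qed
  then show ?thesis by (simp add: p_def)
qed

lemma bregman_nonneg: "x \<in> Dom \<Longrightarrow> z \<in> D \<Longrightarrow> 0 \<le> V x z"
  using bregman_ge[of x z] by (meson divide_nonneg_pos order_trans zero_le_power2 zero_less_numeral)

text \<open>
Separation yields some subgradient at the minimizer \<open>z\<close>, but the method uses the selected one. Moving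
from \<open>z\<close> to \<open>z + t (u - z)\<close> with \<open>u\<close> interior, the increase of \<open>v\<close> is at most \<open>t \<langle>v' (z + t (u - z)), u - z\<rangle>\<close>;
dividing by \<open>t\<close> and letting \<open>t\<close> tend to \<open>0\<close>, continuity of \<open>v'\<close> produces \<open>v' z\<close>. Feasible
boundary points \<open>u\<close> are again reached as limits.
\<close>

lemma minimizer_variational_inequality:
  fixes \<xi> :: "'e \<Rightarrow>\<^sub>L real"
  assumes \<psi>: "convex_on X \<psi>" and \<beta>: "0 < \<beta>" and z: "z \<in> X"
    and min: "\<And>u. u \<in> X \<Longrightarrow> \<xi> z + \<psi> z + \<beta> * v z \<le> \<xi> u + \<psi> u + \<beta> * v u"
  shows "z \<in> Dom" and "u \<in> X \<Longrightarrow> 0 \<le> \<xi> (u - z) + \<psi> u - \<psi> z + \<beta> * v' z (u - z)"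
proof -
  obtain w where w: "w \<in> X" "w \<in> interior D" using X_meets_interior by auto
  have zD: "z \<in> D" using z X_subset by auto
  have "convex_on X (\<lambda>u. (\<xi> u + \<psi> u) / \<beta>)"
  proof (rule convex_onI)
    fix t :: real and x y assume *: "0 < t" "t < 1" "x \<in> X" "y \<in> X"
    have "\<psi> ((1 - t) *\<^sub>R x + t *\<^sub>R y) \<le> (1 - t) * \<psi> x + t * \<psi> y"
      using \<psi> * by (intro convex_onD) auto
    then have "(\<xi> ((1 - t) *\<^sub>R x + t *\<^sub>R y) + \<psi> ((1 - t) *\<^sub>R x + t *\<^sub>R y)) / \<beta>
        \<le> ((1 - t) * (\<xi> x + \<psi> x) + t * (\<xi> y + \<psi> y)) / \<beta>"
      using \<beta> by (intro divide_right_mono) (auto simp: blinfun.add_right blinfun.scaleR_right distrib_left)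
    then show "(\<xi> ((1 - t) *\<^sub>R x + t *\<^sub>R y) + \<psi> ((1 - t) *\<^sub>R x + t *\<^sub>R y)) / \<beta>
        \<le> (1 - t) * ((\<xi> x + \<psi> x) / \<beta>) + t * ((\<xi> y + \<psi> y) / \<beta>)"
      by (simp add: add_divide_distrib distrib_left)
  qed (rule X_convex)
  then show zDom: "z \<in> Dom"
  proof (rule minimizer_in_subdiff_domain[OF v_convex _ X_subset w z])
    show "v z + (\<xi> z + \<psi> z) / \<beta> \<le> v u + (\<xi> u + \<psi> u) / \<beta>" if "u \<in> X" for u
    proof -
      have "(\<xi> z + \<psi> z + \<beta> * v z) / \<beta> \<le> (\<xi> u + \<psi> u + \<beta> * v u) / \<beta>"
        using min[OF that] \<beta> by (intro divide_right_mono) auto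
      then show ?thesis using \<beta> by (simp add: add_divide_distrib)
    qed
  qed
  have interior_case: "0 \<le> \<xi> (u - z) + \<psi> u - \<psi> z + \<beta> * v' z (u - z)"
    if u: "u \<in> X" "u \<in> interior D" for u
  proof -
    define p where "p t = z + t *\<^sub>R (u - z)" for t
    have pint: "p t \<in> interior D" if "0 < t" "t \<le> 1" for t
      using shrink_to_interior[OF zD u(2) that] by (simp add: p_def)
    have pDom: "p t \<in> Dom" if "0 \<le> t" "t \<le> 1" for t
    proof (cases "t = 0")
      case True then show ?thesis using zDom by (simp add: p_def)
    next
      case False
      then show ?thesis using pint[of t] that interior_subset_subdiff_domain[OF v_convex] by auto
    qed
    have p: "continuous_on {0..1} p" unfolding p_def by (intro continuous_intros)
    have "0 \<le> \<xi> (u - z) + \<psi> u - \<psi> z + \<beta> * v' (p 0) (u - z)"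
    proof (rule nonneg_at_0_if_nonneg_after)
      show "continuous_on {0..1} (\<lambda>t. \<xi> (u - z) + \<psi> u - \<psi> z + \<beta> * v' (p t) (u - z))"
        using pDom p
        by (intro continuous_intros continuous_on_compose2[OF v'_continuous]) auto
      fix t :: real assume t: "0 < t" "t \<le> 1"
      have pX: "p t \<in> X" using segment_in_X[OF z u(1), of t] t by (simp add: p_def)
      have "\<psi> (p t) \<le> (1 - t) * \<psi> z + t * \<psi> u"
        using convex_onD[OF \<psi>, of t z u] t z u by (simp add: p_def algebra_simps)
      moreover have "v (p t) - v z \<le> t * v' (p t) (u - z)"
      proof -
        have "v (p t) + v' (p t) (z - p t) \<le> v z"
          using pDom[of t] zD t by (intro subgradient_ineq) auto
        then show ?thesis by (simp add: p_def blinfun.scaleR_right blinfun.minus_right)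
      qed
      then have "\<beta> * (v (p t) - v z) \<le> \<beta> * (t * v' (p t) (u - z))"
        using \<beta> by (intro mult_left_mono) auto
      moreover have "\<xi> (p t) - \<xi> z = t * \<xi> (u - z)"
        by (simp add: p_def blinfun.add_right blinfun.scaleR_right)
      ultimately have "0 \<le> t * (\<xi> (u - z) + \<psi> u - \<psi> z + \<beta> * v' (p t) (u - z))"
        using min[OF pX] by (simp add: algebra_simps)
      then show "0 \<le> \<xi> (u - z) + \<psi> u - \<psi> z + \<beta> * v' (p t) (u - z)"
        using t by (simp add: zero_le_mult_iff)
    qed
    then show ?thesis by (simp add: p_def)
  qed
  show "0 \<le> \<xi> (u - z) + \<psi> u - \<psi> z + \<beta> * v' z (u - z)" if u: "u \<in> X"
  proof -
    define p where "p t = u + t *\<^sub>R (w - u)" for t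
    have "0 \<le> \<xi> (p 0 - z) + ((1 - 0) * \<psi> u + 0 * \<psi> w) - \<psi> z + \<beta> * v' z (p 0 - z)"
    proof (rule nonneg_at_0_if_nonneg_after)
      show "continuous_on {0..1}
          (\<lambda>t. \<xi> (p t - z) + ((1 - t) * \<psi> u + t * \<psi> w) - \<psi> z + \<beta> * v' z (p t - z))"
        unfolding p_def by (intro continuous_intros)
      fix t :: real assume t: "0 < t" "t \<le> 1"
      have "p t \<in> X" "p t \<in> interior D"
        using segment_in_X[OF u w(1), of t] shrink_to_interior[OF _ w(2) t, of u] X_subset u t
        by (auto simp: p_def)
      moreover have "\<psi> (p t) \<le> (1 - t) * \<psi> u + t * \<psi> w"
        using convex_onD[OF \<psi>, of t u w] t w u by (simp add: p_def algebra_simps)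
      ultimately show "0 \<le> \<xi> (p t - z) + ((1 - t) * \<psi> u + t * \<psi> w) - \<psi> z + \<beta> * v' z (p t - z)"
        using interior_case[of "p t"] by linarith
    qed
    then show ?thesis by (simp add: p_def)
  qed
qed

text \<open>
A prox step depends on its centre \<open>x\<close> only through \<open>\<xi> - \<beta> v' x\<close>. Factoring it through this dual
vector reduces its measurability to the continuity of one map on the dual space.
\<close>

definition mirror_map :: "('e \<Rightarrow> real) \<Rightarrow> real \<Rightarrow> ('e \<Rightarrow>\<^sub>L real) \<Rightarrow> 'e" where
  "mirror_map \<psi> \<beta> \<xi> = arg_min_on (\<lambda>z. \<xi> z + \<psi> z + \<beta> * v z) X"

lemma prox_eq_mirror_map: "prox X \<psi> V \<beta> x \<xi> = mirror_map \<psi> \<beta> (\<xi> - \<beta> *\<^sub>R v' x)"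
proof -
  have "(\<lambda>z. \<xi> z + \<psi> z + \<beta> * V x z)
      = (\<lambda>z. ((\<xi> - \<beta> *\<^sub>R v' x) z + \<psi> z + \<beta> * v z) + \<beta> * (v' x x - v x))"
    by (simp add: fun_eq_iff bregman_def blinfun.diff_left blinfun.diff_right blinfun.scaleR_left
        algebra_simps)
  then show ?thesis
    by (simp add: prox_def mirror_map_def arg_min_on_def arg_min_def is_arg_min_def)
qed

context
  fixes \<psi> :: "'e \<Rightarrow> real" and \<beta> :: real
  assumes \<psi>: "convex_on X \<psi>" "continuous_on X \<psi>" and \<beta>: "0 < \<beta>"
begin

lemma mirror_map_minimizes:
  "mirror_map \<psi> \<beta> \<xi> \<in> X"
  "u \<in> X \<Longrightarrow> \<xi> (mirror_map \<psi> \<beta> \<xi>) + \<psi> (mirror_map \<psi> \<beta> \<xi>) + \<beta> * v (mirror_map \<psi> \<beta> \<xi>)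
     \<le> \<xi> u + \<psi> u + \<beta> * v u"
proof -
  let ?f = "\<lambda>z. \<xi> z + \<psi> z + \<beta> * v z"
  have "continuous_on X ?f"
    by (intro continuous_intros \<psi> continuous_on_subset[OF v_continuous X_subset])
  then obtain z where "z \<in> X" "\<And>y. y \<in> X \<Longrightarrow> ?f z \<le> ?f y"
    using continuous_attains_inf[OF X_compact] X_meets_interior by blast
  then have "is_arg_min ?f (\<lambda>x. x \<in> X) z" by (auto simp: is_arg_min_linorder)
  then have "is_arg_min ?f (\<lambda>x. x \<in> X) (mirror_map \<psi> \<beta> \<xi>)"
    unfolding mirror_map_def arg_min_on_def arg_min_def by (rule someI)
  then show "mirror_map \<psi> \<beta> \<xi> \<in> X"
    "u \<in> X \<Longrightarrow> ?f (mirror_map \<psi> \<beta> \<xi>) \<le> ?f u"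
    by (auto simp: is_arg_min_linorder)
qed

lemma mirror_map_in_Dom: "mirror_map \<psi> \<beta> \<xi> \<in> Dom"
  by (rule minimizer_variational_inequality(1)[OF \<psi>(1) \<beta> mirror_map_minimizes])

lemma mirror_map_variational_inequality:
  assumes "u \<in> X"
  shows "0 \<le> \<xi> (u - mirror_map \<psi> \<beta> \<xi>) + \<psi> u - \<psi> (mirror_map \<psi> \<beta> \<xi>)
           + \<beta> * v' (mirror_map \<psi> \<beta> \<xi>) (u - mirror_map \<psi> \<beta> \<xi>)"
  by (rule minimizer_variational_inequality(2)[OF \<psi>(1) \<beta> mirror_map_minimizes assms])

text \<open>
Adding the two variational inequalities, each tested at the other minimizer, and using strong
monotonicity.
\<close>

lemma mirror_map_lipschitz:
  "\<beta> * nrm (mirror_map \<psi> \<beta> \<xi> - mirror_map \<psi> \<beta> \<eta>) \<le> dual_norm nrm (\<xi> - \<eta>)"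
proof -
  let ?p = "mirror_map \<psi> \<beta> \<xi>" and ?q = "mirror_map \<psi> \<beta> \<eta>"
  have "\<beta> * (nrm (?p - ?q))\<^sup>2 \<le> \<beta> * (v' ?p - v' ?q) (?p - ?q)"
    using \<beta> by (intro mult_left_mono v'_strongly_monotone mirror_map_in_Dom) auto
  also have "\<dots> \<le> (\<eta> - \<xi>) (?p - ?q)"
    using mirror_map_variational_inequality[of ?q \<xi>] mirror_map_variational_inequality[of ?p \<eta>]
      mirror_map_minimizes(1)
    by (simp add: blinfun.diff_left blinfun.diff_right algebra_simps)
  also have "\<dots> \<le> dual_norm nrm (\<eta> - \<xi>) * nrm (?p - ?q)"
    by (rule apply_le_dual_norm)
  finally have "nrm (?p - ?q) * (\<beta> * nrm (?p - ?q)) \<le> nrm (?p - ?q) * dual_norm nrm (\<xi> - \<eta>)"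
    by (simp add: power2_eq_square mult_ac dual_norm_minus_commute[of \<eta>])
  then show ?thesis
    by (cases "nrm (?p - ?q) = 0") (auto simp del: nrm_eq_0_iff simp: mult_le_cancel_left nrm_nonneg order.not_eq_order_implies_strict)
qed

lemma continuous_on_mirror_map: "continuous_on A (mirror_map \<psi> \<beta>)"
proof -
  obtain m where m: "0 < m" "\<And>x. norm x \<le> m * nrm x" using nrm_dominates_norm by blast
  obtain k where k: "0 < k" "\<And>s. dual_norm nrm s \<le> k * norm s" using dual_norm_le_norm by blast
  have "(m / \<beta> * k)-lipschitz_on A (mirror_map \<psi> \<beta>)"
  proof (rule lipschitz_onI)
    fix \<xi> \<eta> :: "'e \<Rightarrow>\<^sub>L real"
    let ?d = "mirror_map \<psi> \<beta> \<xi> - mirror_map \<psi> \<beta> \<eta>"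
    have "norm ?d \<le> m / \<beta> * (\<beta> * nrm ?d)" using m(2)[of ?d] \<beta> by simp
    also have "\<dots> \<le> m / \<beta> * (k * norm (\<xi> - \<eta>))"
      using m k(2) \<beta> order_trans[OF mirror_map_lipschitz] by (intro mult_left_mono) auto
    finally show "dist (mirror_map \<psi> \<beta> \<xi>) (mirror_map \<psi> \<beta> \<eta>) \<le> m / \<beta> * k * dist \<xi> \<eta>"
      by (simp add: dist_norm mult.assoc)
  qed (use m k \<beta> in auto)
  then show ?thesis by (rule lipschitz_on_continuous_on)
qed

lemma continuous_on_v'_mirror_map: "continuous_on A (\<lambda>\<xi>. v' (mirror_map \<psi> \<beta> \<xi>))"
  by (rule continuous_on_compose2[OF v'_continuous continuous_on_mirror_map])
    (use mirror_map_in_Dom in auto)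

lemma prox_in_X: "prox X \<psi> V \<beta> x \<xi> \<in> X"
  by (simp add: prox_eq_mirror_map mirror_map_minimizes)

lemma prox_in_Dom: "prox X \<psi> V \<beta> x \<xi> \<in> Dom"
  by (simp add: prox_eq_mirror_map mirror_map_in_Dom)

text \<open>
The variational inequality, rewritten by
\<open>V\<^sub>x(u) - V\<^sub>y(u) - V\<^sub>x(y) = \<langle>v' y - v' x, u - y\<rangle>\<close>.
\<close>

lemma prox_three_point:
  fixes \<xi> :: "'e \<Rightarrow>\<^sub>L real"
  assumes "u \<in> X" and y: "y = prox X \<psi> V \<beta> x \<xi>"
  shows "\<xi> (y - u) + \<psi> y - \<psi> u \<le> \<beta> * (V x u - V y u - V x y)"
proof -
  have "0 \<le> (\<xi> - \<beta> *\<^sub>R v' x) (u - y) + \<psi> u - \<psi> y + \<beta> * v' y (u - y)"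
    using mirror_map_variational_inequality[OF assms(1)] by (simp add: y prox_eq_mirror_map)
  then show ?thesis
    by (simp add: bregman_def blinfun.diff_left blinfun.diff_right blinfun.scaleR_left algebra_simps)
qed

end

text \<open>
Mirror descent for a sequence of linear losses. Losses are numbered from \<open>1\<close>, like the samples of
the stochastic method.
\<close>

primrec mirror_iter :: "real \<Rightarrow> 'e \<Rightarrow> (nat \<Rightarrow> 'e \<Rightarrow>\<^sub>L real) \<Rightarrow> nat \<Rightarrow> 'e" where
  "mirror_iter \<beta> x g 0 = x"
| "mirror_iter \<beta> x g (Suc i) = prox X (\<lambda>_. 0) V \<beta> (mirror_iter \<beta> x g i) (g (Suc i))"

lemma zero_admissible: "convex_on X (\<lambda>_. 0)" "continuous_on X (\<lambda>_. 0)"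
  using X_convex by (simp_all add: convex_on_def)

lemma mirror_iter_in:
  assumes "0 < \<beta>" "x \<in> X" "x \<in> Dom"
  shows "mirror_iter \<beta> x g i \<in> X" "mirror_iter \<beta> x g i \<in> Dom"
  using assms prox_in_X[OF zero_admissible] prox_in_Dom[OF zero_admissible] by (cases i; simp)+

text \<open>
The classical regret bound. Moving the loss from the new iterate to the old one costs
\<open>\<parallel>g\<parallel> \<parallel>y - y'\<parallel>\<close>, which Young's inequality splits into \<open>\<parallel>g\<parallel>\<^sup>2 / (2 \<beta>)\<close> and a
part absorbed by the Bregman term of the step.
\<close>

lemma mirror_iter_regret:
  assumes \<beta>: "0 < \<beta>" and x: "x \<in> X" "x \<in> Dom" and u: "u \<in> X"
  shows "(\<Sum>i=1..n. g i (mirror_iter \<beta> x g (i - 1) - u))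
    \<le> \<beta> * V x u + (\<Sum>i=1..n. (dual_norm nrm (g i))\<^sup>2) / (2 * \<beta>)"
proof -
  let ?z = "mirror_iter \<beta> x g"
  have "(\<Sum>i=1..n. g i (?z (i - 1) - u))
    \<le> \<beta> * (V x u - V (?z n) u) + (\<Sum>i=1..n. (dual_norm nrm (g i))\<^sup>2) / (2 * \<beta>)"
  proof (induction n)
    case (Suc n)
    let ?g = "g (Suc n)" and ?y = "?z n" and ?y' = "?z (Suc n)"
    have y: "?y \<in> Dom" and y': "?y' \<in> D" "?y' \<in> Dom"
      using mirror_iter_in[OF \<beta> x] Dom_subset by blast+
    have "?g (?y' - u) \<le> \<beta> * (V ?y u - V ?y' u - V ?y ?y')"
      using prox_three_point[OF zero_admissible \<beta> u, of ?y' ?y ?g] by simp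
    moreover have "?g (?y - ?y') \<le> (dual_norm nrm ?g)\<^sup>2 / (2 * \<beta>) + \<beta> * V ?y ?y'"
    proof -
      have "?g (?y - ?y') \<le> dual_norm nrm ?g * nrm (?y' - ?y)"
        using apply_le_dual_norm[of ?g "?y - ?y'"] by (simp add: nrm_minus_commute)
      also have "\<dots> \<le> (dual_norm nrm ?g)\<^sup>2 / (2 * \<beta>) + \<beta> * ((nrm (?y' - ?y))\<^sup>2 / 2)"
        by (rule young_inequality[OF \<beta>])
      also have "\<beta> * ((nrm (?y' - ?y))\<^sup>2 / 2) \<le> \<beta> * V ?y ?y'"
        using bregman_ge[OF y y'(1)] \<beta> by (intro mult_left_mono) auto
      finally show ?thesis by simp
    qed
    moreover have "?g (?y - u) = ?g (?y' - u) + ?g (?y - ?y')"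
      by (simp add: blinfun.diff_right)
    ultimately show ?case
      using Suc.IH by (simp add: add_divide_distrib right_diff_distrib del: mirror_iter.simps)
  qed simp
  also have "\<beta> * (V x u - V (?z n) u) \<le> \<beta> * V x u"
    using bregman_nonneg[of "?z n" u] mirror_iter_in(2)[OF \<beta> x] u X_subset \<beta>
    by (intro mult_left_mono) auto
  finally show ?thesis by simp
qed

text \<open>
At a minimizer over \<open>X\<close> the linear term of the Bregman distance is nonnegative on \<open>X\<close>, by the
variational inequality for \<open>\<xi> = 0\<close> and \<open>\<psi> = 0\<close>.
\<close>

lemma bregman_le_at_minimizer:
  assumes x: "x \<in> X" and min: "\<And>u. u \<in> X \<Longrightarrow> v x \<le> v u" and u: "u \<in> X"
  shows "V x u \<le> v u - v x"
  using minimizer_variational_inequality(2)[OF zero_admissible(1) zero_less_one x _ u, of 0] min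
  by (simp add: bregman_def)

end

section \<open>Tail bounds for adapted sums on a product space\<close>

lemma exp_le_one_plus_self_plus_square:
  fixes u :: real
  assumes "u \<le> 1"
  shows "exp u \<le> 1 + u + u\<^sup>2"
proof (cases "0 \<le> u")
  case True
  then show ?thesis using assms by (rule exp_bound)
next
  case False
  define y where "y = - u"
  have y: "0 < y" using False by (simp add: y_def)
  have "1 \<le> (1 - y + y\<^sup>2) * (1 + y + y\<^sup>2 / 2)"
  proof -
    have "(1 - y + y\<^sup>2) * (1 + y + y\<^sup>2 / 2) = 1 + y ^ 2 / 2 + y ^ 3 / 2 + y ^ 4 / 2"
      by (simp add: field_simps power2_eq_square power3_eq_cube power4_eq_xxxx)
    then show ?thesis using y by simp
  qed
  also have "\<dots> \<le> (1 - y + y\<^sup>2) * exp y"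
  proof (rule mult_left_mono)
    have "0 \<le> (1 - y)\<^sup>2" by simp
    then show "0 \<le> 1 - y + y\<^sup>2" using y by (simp add: power2_diff)
  qed (use y exp_lower_Taylor_quadratic[of y] in simp)
  finally have "exp (- y) \<le> 1 - y + y\<^sup>2"
    by (simp add: exp_minus divide_simps)
  then show ?thesis by (simp add: y_def)
qed

context prob_space
begin

text \<open>
Bernstein's argument with the exponent fixed at \<open>1 / b\<close>: the scaled variable is at most \<open>1\<close>, where
the exponential is dominated by a quadratic, so only mean and second moment enter.
\<close>

lemma nn_integral_exp_le:
  fixes g :: "'a \<Rightarrow> real"
  assumes int: "integrable M g" "integrable M (\<lambda>w. (g w)\<^sup>2)"
    and bound: "\<And>w. w \<in> space M \<Longrightarrow> g w \<le> b" and b: "0 < b"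
    and mean: "(\<integral>w. g w \<partial>M) \<le> m" and var: "(\<integral>w. (g w)\<^sup>2 \<partial>M) \<le> s"
  shows "(\<integral>\<^sup>+w. ennreal (exp (g w / b)) \<partial>M) \<le> ennreal (exp (m / b + s / b\<^sup>2))"
proof -
  let ?q = "\<lambda>w. 1 + g w / b + (g w / b)\<^sup>2"
  have le: "exp (g w / b) \<le> ?q w" if "w \<in> space M" for w
    using bound[OF that] b by (intro exp_le_one_plus_self_plus_square) simp
  have intq: "integrable M ?q"
    using int by (auto simp: power_divide)
  have "(\<integral>\<^sup>+w. ennreal (exp (g w / b)) \<partial>M) \<le> (\<integral>\<^sup>+w. ennreal (?q w) \<partial>M)"
    by (intro nn_integral_mono ennreal_leI le)
  also have "\<dots> = ennreal (\<integral>w. ?q w \<partial>M)"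
    by (intro nn_integral_eq_integral intq AE_I2) (meson le exp_ge_zero order_trans)
  also have "(\<integral>w. ?q w \<partial>M) = 1 + (\<integral>w. g w \<partial>M) / b + (\<integral>w. (g w)\<^sup>2 \<partial>M) / b\<^sup>2"
    using int by (simp add: power_divide prob_space)
  also have "\<dots> \<le> 1 + (m / b + s / b\<^sup>2)"
    using divide_right_mono[OF mean, of b] divide_right_mono[OF var, of "b\<^sup>2"] b by simp
  also have "\<dots> \<le> exp (m / b + s / b\<^sup>2)" by (rule exp_ge_add_one_self)
  finally show ?thesis by (simp add: ennreal_leI)
qed

text \<open>
The exponential supermartingale argument without filtrations or conditional expectations: since the first
\<open>n\<close> summands ignore coordinate \<open>Suc n\<close>, Fubini's theorem integrates that coordinate out first.
\<close>

lemma nn_integral_exp_adapted_sum: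
  fixes h :: "nat \<Rightarrow> (nat \<Rightarrow> 'a) \<Rightarrow> real"
  assumes meas: "\<And>k n. 1 \<le> k \<Longrightarrow> k \<le> n \<Longrightarrow> h k \<in> borel_measurable (\<Pi>\<^sub>M i\<in>{1..n}. M)"
    and adapted: "\<And>k n \<omega> w. k \<le> n \<Longrightarrow> h k (\<omega> (Suc n := w)) = h k \<omega>"
    and step: "\<And>n \<omega>. \<omega> \<in> space (\<Pi>\<^sub>M i\<in>{1..n}. M) \<Longrightarrow>
      (\<integral>\<^sup>+w. ennreal (exp (h (Suc n) (\<omega> (Suc n := w)))) \<partial>M) \<le> ennreal (exp c)"
  shows "(\<integral>\<^sup>+\<omega>. ennreal (exp (\<Sum>k=1..n. h k \<omega>)) \<partial>(\<Pi>\<^sub>M i\<in>{1..n}. M)) \<le> ennreal (exp (real n * c))"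
proof (induction n)
  case 0
  interpret PM: prob_space "\<Pi>\<^sub>M i\<in>{1..0::nat}. M" by (intro prob_space_PiM) unfold_locales
  show ?case using PM.emeasure_space_1 by simp
next
  case (Suc n)
  interpret product_sigma_finite "\<lambda>_ :: nat. M" by unfold_locales
  have ins: "{1..Suc n} = insert (Suc n) {1..n}" by auto
  have m: "(\<lambda>\<omega>. \<Sum>k=1..n. h k \<omega>) \<in> borel_measurable (\<Pi>\<^sub>M i\<in>{1..n}. M)"
    by (intro borel_measurable_sum meas) auto
  have "(\<lambda>\<omega>. \<Sum>k=1..Suc n. h k \<omega>) \<in> borel_measurable (\<Pi>\<^sub>M i\<in>{1..Suc n}. M)"
    by (intro borel_measurable_sum meas) auto
  then have mSuc: "(\<lambda>\<omega>. ennreal (exp (\<Sum>k=1..Suc n. h k \<omega>)))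
      \<in> borel_measurable (\<Pi>\<^sub>M i\<in>insert (Suc n) {1..n}. M)"
    unfolding ins[symmetric] by measurable
  have mh: "(\<lambda>w. h (Suc n) (\<omega> (Suc n := w))) \<in> borel_measurable M"
    if "\<omega> \<in> space (\<Pi>\<^sub>M i\<in>{1..n}. M)" for \<omega>
  proof (rule measurable_compose[of _ M "\<Pi>\<^sub>M i\<in>{1..Suc n}. M"])
    show "(\<lambda>w. \<omega> (Suc n := w)) \<in> measurable M (\<Pi>\<^sub>M i\<in>{1..Suc n}. M)"
      unfolding ins by (rule measurable_component_update[OF that]) simp
  qed (intro meas; simp)
  have "(\<integral>\<^sup>+\<omega>. ennreal (exp (\<Sum>k=1..Suc n. h k \<omega>)) \<partial>(\<Pi>\<^sub>M i\<in>{1..Suc n}. M))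
      = (\<integral>\<^sup>+\<omega>. (\<integral>\<^sup>+w. ennreal (exp (\<Sum>k=1..Suc n. h k (\<omega> (Suc n := w)))) \<partial>M) \<partial>(\<Pi>\<^sub>M i\<in>{1..n}. M))"
    using product_nn_integral_insert[OF _ _ mSuc] unfolding ins[symmetric] by (simp del: sum.cl_ivl_Suc)
  also have "\<dots> = (\<integral>\<^sup>+\<omega>. ennreal (exp (\<Sum>k=1..n. h k \<omega>)) *
      (\<integral>\<^sup>+w. ennreal (exp (h (Suc n) (\<omega> (Suc n := w)))) \<partial>M) \<partial>(\<Pi>\<^sub>M i\<in>{1..n}. M))"
  proof (rule nn_integral_cong)
    fix \<omega> assume \<omega>: "\<omega> \<in> space (\<Pi>\<^sub>M i\<in>{1..n}. M)"
    have "(\<Sum>k=1..Suc n. h k (\<omega> (Suc n := w))) = (\<Sum>k=1..n. h k \<omega>) + h (Suc n) (\<omega> (Suc n := w))" for w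
      by (simp add: adapted)
    then show "(\<integral>\<^sup>+w. ennreal (exp (\<Sum>k=1..Suc n. h k (\<omega> (Suc n := w)))) \<partial>M)
        = ennreal (exp (\<Sum>k=1..n. h k \<omega>)) * (\<integral>\<^sup>+w. ennreal (exp (h (Suc n) (\<omega> (Suc n := w)))) \<partial>M)"
      using mh[OF \<omega>] by (simp add: exp_add ennreal_mult nn_integral_cmult)
  qed
  also have "\<dots> \<le> (\<integral>\<^sup>+\<omega>. ennreal (exp (\<Sum>k=1..n. h k \<omega>)) * ennreal (exp c) \<partial>(\<Pi>\<^sub>M i\<in>{1..n}. M))"
    by (intro nn_integral_mono mult_left_mono step) auto
  also have "\<dots> = (\<integral>\<^sup>+\<omega>. ennreal (exp (\<Sum>k=1..n. h k \<omega>)) \<partial>(\<Pi>\<^sub>M i\<in>{1..n}. M)) * ennreal (exp c)"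
    by (rule nn_integral_multc, rule measurable_compose[OF m]) measurable
  also have "\<dots> \<le> ennreal (exp (real n * c)) * ennreal (exp c)"
    by (intro mult_right_mono Suc.IH) simp
  also have "\<dots> = ennreal (exp (real (Suc n) * c))"
    by (simp add: ennreal_mult[symmetric] exp_add[symmetric] algebra_simps)
  finally show ?case .
qed

lemma adapted_sum_tail:
  fixes h :: "nat \<Rightarrow> (nat \<Rightarrow> 'a) \<Rightarrow> real"
  assumes meas: "\<And>k n. 1 \<le> k \<Longrightarrow> k \<le> n \<Longrightarrow> h k \<in> borel_measurable (\<Pi>\<^sub>M i\<in>{1..n}. M)"
    and adapted: "\<And>k n \<omega> w. k \<le> n \<Longrightarrow> h k (\<omega> (Suc n := w)) = h k \<omega>"
    and b: "0 < b"
    and bound: "\<And>n \<omega> w. \<omega> \<in> space (\<Pi>\<^sub>M i\<in>{1..n}. M) \<Longrightarrow> w \<in> space M \<Longrightarrow>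
      h (Suc n) (\<omega> (Suc n := w)) \<le> b"
    and int: "\<And>n \<omega>. \<omega> \<in> space (\<Pi>\<^sub>M i\<in>{1..n}. M) \<Longrightarrow>
      integrable M (\<lambda>w. h (Suc n) (\<omega> (Suc n := w)))"
    and int2: "\<And>n \<omega>. \<omega> \<in> space (\<Pi>\<^sub>M i\<in>{1..n}. M) \<Longrightarrow>
      integrable M (\<lambda>w. (h (Suc n) (\<omega> (Suc n := w)))\<^sup>2)"
    and mean: "\<And>n \<omega>. \<omega> \<in> space (\<Pi>\<^sub>M i\<in>{1..n}. M) \<Longrightarrow>
      (\<integral>w. h (Suc n) (\<omega> (Suc n := w)) \<partial>M) \<le> m"
    and var: "\<And>n \<omega>. \<omega> \<in> space (\<Pi>\<^sub>M i\<in>{1..n}. M) \<Longrightarrow>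
      (\<integral>w. (h (Suc n) (\<omega> (Suc n := w)))\<^sup>2 \<partial>M) \<le> s"
  shows "\<P>(\<omega> in \<Pi>\<^sub>M i\<in>{1..n}. M. real n * (m + s / b) + b * \<tau> \<le> (\<Sum>k=1..n. h k \<omega>)) \<le> exp (- \<tau>)"
proof -
  let ?PM = "\<Pi>\<^sub>M i\<in>{1..n}. M" and ?S = "\<lambda>\<omega>. \<Sum>k=1..n. h k \<omega> / b"
  interpret PM: prob_space ?PM by (intro prob_space_PiM) unfold_locales
  define c where "c = m / b + s / b\<^sup>2"
  have S [measurable]: "?S \<in> borel_measurable ?PM"
    by (intro borel_measurable_sum borel_measurable_divide meas borel_measurable_const) auto
  have exp_S: "(\<integral>\<^sup>+\<omega>. ennreal (exp (?S \<omega>)) \<partial>?PM) \<le> ennreal (exp (real n * c))"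
  proof (rule nn_integral_exp_adapted_sum)
    show "(\<lambda>\<omega>. h k \<omega> / b) \<in> borel_measurable (\<Pi>\<^sub>M i\<in>{1..n}. M)" if "1 \<le> k" "k \<le> n" for k n
      by (intro borel_measurable_divide meas that) simp
    show "(\<integral>\<^sup>+w. ennreal (exp (h (Suc n) (\<omega> (Suc n := w)) / b)) \<partial>M) \<le> ennreal (exp c)"
      if "\<omega> \<in> space (\<Pi>\<^sub>M i\<in>{1..n}. M)" for n \<omega>
      unfolding c_def by (intro nn_integral_exp_le int int2 bound mean var that b)
  qed (simp add: adapted)
  have eq: "real n * (m + s / b) + b * \<tau> \<le> (\<Sum>k=1..n. h k \<omega>) \<longleftrightarrow> real n * c + \<tau> \<le> ?S \<omega>" for \<omega>
  proof -
    have "real n * c + \<tau> = (real n * (m + s / b) + b * \<tau>) / b"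
      using b by (simp add: c_def field_simps power2_eq_square)
    then show ?thesis using b by (simp add: divide_le_cancel flip: sum_divide_distrib)
  qed
  have "emeasure ?PM {\<omega> \<in> space ?PM. 1 \<le> ennreal (exp (- (real n * c + \<tau>))) * ennreal (exp (?S \<omega>))}
      \<le> ennreal (exp (- (real n * c + \<tau>))) *
         (\<integral>\<^sup>+\<omega>. ennreal (exp (?S \<omega>)) * indicator (space ?PM) \<omega> \<partial>?PM)"
    by (rule nn_integral_Markov_inequality; measurable)
  also have "\<dots> = ennreal (exp (- (real n * c + \<tau>))) * (\<integral>\<^sup>+\<omega>. ennreal (exp (?S \<omega>)) \<partial>?PM)"
    by (intro arg_cong2[where f = "(*)"] refl nn_integral_cong) simp
  also have "\<dots> \<le> ennreal (exp (- (real n * c + \<tau>))) * ennreal (exp (real n * c))"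
    by (intro mult_left_mono exp_S) simp
  also have "\<dots> = ennreal (exp (- \<tau>))"
    by (simp add: ennreal_mult[symmetric] exp_add[symmetric])
  also have "{\<omega> \<in> space ?PM. 1 \<le> ennreal (exp (- (real n * c + \<tau>))) * ennreal (exp (?S \<omega>))}
      = {\<omega> \<in> space ?PM. real n * (m + s / b) + b * \<tau> \<le> (\<Sum>k=1..n. h k \<omega>)}"
    unfolding eq by (simp add: ennreal_mult[symmetric] exp_add[symmetric] flip: ennreal_1) auto
  finally show ?thesis
    unfolding PM.emeasure_eq_measure by simp
qed

end

section \<open>The setting of the stochastic method\<close>

context rsmd_setting
begin

abbreviation (input) \<phi> :: "'e \<Rightarrow> real" where "\<phi> \<equiv> expected_value P \<Phi>"

abbreviation (input) proxy_domain :: "'e set" where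
  "proxy_domain \<equiv> {x. nrm (x - x0) \<le> R}"

lemma in_proxy_domain_iff:
  assumes "is_norm nrm"
  shows "x \<in> proxy_domain \<longleftrightarrow> (x - x0) /\<^sub>R R \<in> unit_ball nrm"
proof -
  interpret finite_dim_norm nrm by unfold_locales (rule assms)
  show ?thesis
    using R_pos by (simp add: unit_ball_def nrm_scaleR pos_divide_le_eq flip: divide_inverse_commute)
qed

lemma x0_in_interior_proxy_domain: "x0 \<in> interior proxy_domain"
proof -
  interpret finite_dim_norm nrm by unfold_locales (rule nrm)
  show ?thesis
  proof (rule interiorI)
    show "open {x. nrm (x - x0) < R}"
      by (intro open_Collect_less continuous_intros continuous_on_compose2[OF continuous_on_nrm]) auto
  qed (use R_pos in auto)
qed

text \<open>
Dividing a subgradient of the rescaled proxy \<open>R\<^sup>2 \<theta>((x - x\<^sub>0) / R)\<close> by \<open>R\<close> gives one of \<open>\<theta>\<close>.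
\<close>

lemma subdiff_domain_scaled_proxy:
  assumes x: "x \<in> subdiff_domain (scaled_proxy \<theta> x0 R) proxy_domain"
  shows "(x - x0) /\<^sub>R R \<in> subdiff_domain \<theta> (unit_ball nrm)"
proof -
  let ?u = "(x - x0) /\<^sub>R R"
  obtain s where s: "\<And>z. z \<in> proxy_domain \<Longrightarrow>
      scaled_proxy \<theta> x0 R x + blinfun_apply s (z - x) \<le> scaled_proxy \<theta> x0 R z"
    using x unfolding subdiff_domain_def subdifferential_def by blast
  have "\<theta> ?u + (s /\<^sub>R R) (y - ?u) \<le> \<theta> y" if y: "y \<in> unit_ball nrm" for y
  proof -
    have *: "(x0 + R *\<^sub>R y - x0) /\<^sub>R R = y" using R_pos by simp
    have "x0 + R *\<^sub>R y - x = R *\<^sub>R (y - ?u)" using R_pos by (simp add: algebra_simps)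
    moreover have "x0 + R *\<^sub>R y \<in> proxy_domain"
      using in_proxy_domain_iff[OF nrm, of "x0 + R *\<^sub>R y"] y R_pos by simp
    ultimately have "R\<^sup>2 * \<theta> ?u + R * s (y - ?u) \<le> R\<^sup>2 * \<theta> y"
      using s[of "x0 + R *\<^sub>R y"] * by (simp add: scaled_proxy_def blinfun.scaleR_right)
    moreover have "R\<^sup>2 * ((s /\<^sub>R R) (y - ?u)) = R * s (y - ?u)"
      using R_pos by (simp add: blinfun.scaleR_left power2_eq_square)
    ultimately have "R\<^sup>2 * (\<theta> ?u + (s /\<^sub>R R) (y - ?u)) \<le> R\<^sup>2 * \<theta> y"
      by (simp add: distrib_left)
    then show ?thesis using R_pos by simp
  qed
  then have "s /\<^sub>R R \<in> subdifferential \<theta> (unit_ball nrm) ?u"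
    by (simp add: subdifferential_def)
  moreover have "?u \<in> unit_ball nrm"
    using x in_proxy_domain_iff[OF nrm, of x] by (simp add: subdiff_domain_def)
  ultimately show ?thesis by (auto simp: subdiff_domain_def)
qed

end

text \<open>
The point \<open>x0\<close> is feasible and interior to the ball on which the proxy lives, which is what the
general theory of the mirror step asks of the feasible set. The modulus of strong monotonicity survives because
\<open>v\<close> is scaled by \<open>R\<^sup>2\<close> and its argument by \<open>1 / R\<close>.
\<close>

sublocale rsmd_setting \<subseteq> mirror_setup nrm "proxy_domain" "scaled_proxy \<theta> x0 R"
  "scaled_proxy_grad \<theta>' x0 R" X
proof -
  let ?D = "proxy_domain" and ?v = "scaled_proxy \<theta> x0 R" and ?v' = "scaled_proxy_grad \<theta>' x0 R"
  let ?s = "\<lambda>x. (x - x0) /\<^sub>R R"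
  interpret finite_dim_norm nrm by unfold_locales (rule nrm)
  note D_iff = in_proxy_domain_iff[OF nrm]
  have s_affine: "?s (a *\<^sub>R x + b *\<^sub>R y) = a *\<^sub>R ?s x + b *\<^sub>R ?s y" if "a + b = 1" for a b x y
  proof -
    have "a *\<^sub>R x0 + b *\<^sub>R x0 = x0" using that by (simp flip: scaleR_left_distrib)
    then have "a *\<^sub>R x + b *\<^sub>R y - x0 = a *\<^sub>R (x - x0) + b *\<^sub>R (y - x0)"
      by (simp add: algebra_simps)
    then show ?thesis by (simp add: scaleR_right_distrib mult.commute)
  qed
  have convex_D: "convex ?D"
  proof (rule convexI)
    fix x y :: 'e and a b :: real
    assume *: "x \<in> ?D" "y \<in> ?D" "0 \<le> a" "0 \<le> b" "a + b = 1"
    then show "a *\<^sub>R x + b *\<^sub>R y \<in> ?D"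
      using convex_unit_ball unfolding D_iff s_affine[OF *(5)] convex_def by blast
  qed
  show "mirror_setup nrm ?D ?v ?v' X"
  proof
    show "continuous_on ?D ?v"
      unfolding scaled_proxy_def
      by (intro continuous_intros continuous_on_compose2[OF \<theta>(1)]) (use D_iff in auto)
    show "convex_on ?D ?v"
    proof (rule convex_onI)
      fix t :: real and x y assume *: "0 < t" "t < 1" "x \<in> ?D" "y \<in> ?D"
      have "\<theta> ((1 - t) *\<^sub>R ?s x + t *\<^sub>R ?s y) \<le> (1 - t) * \<theta> (?s x) + t * \<theta> (?s y)"
        using * D_iff[of x] D_iff[of y] by (intro convex_onD[OF \<theta>(2)]) auto
      then have "R\<^sup>2 * \<theta> ((1 - t) *\<^sub>R ?s x + t *\<^sub>R ?s y) \<le> R\<^sup>2 * ((1 - t) * \<theta> (?s x) + t * \<theta> (?s y))"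
        by (intro mult_left_mono) auto
      then show "?v ((1 - t) *\<^sub>R x + t *\<^sub>R y) \<le> (1 - t) * ?v x + t * ?v y"
        using s_affine[of "1 - t" t x y] by (simp add: scaled_proxy_def algebra_simps)
    qed (rule convex_D)
    show "?v' x \<in> subdifferential ?v ?D x" if x: "x \<in> subdiff_domain ?v ?D" for x
      unfolding subdifferential_def
    proof (intro CollectI ballI)
      fix z assume "z \<in> ?D"
      then have "\<theta> (?s x) + \<theta>' (?s x) (?s z - ?s x) \<le> \<theta> (?s z)"
        using \<theta>'_subgradient[OF subdiff_domain_scaled_proxy[OF x]] D_iff[of z]
        by (auto simp: subdifferential_def)
      then have "R\<^sup>2 * (\<theta> (?s x) + \<theta>' (?s x) (?s z - ?s x)) \<le> R\<^sup>2 * \<theta> (?s z)"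
        by (intro mult_left_mono) auto
      moreover have "?s z - ?s x = (z - x) /\<^sub>R R" by (simp add: algebra_simps)
      moreover have "R * R * (inverse R * c) = R * c" for c using R_pos by simp
      ultimately show "?v x + ?v' x (z - x) \<le> ?v z"
        by (simp add: scaled_proxy_def scaled_proxy_grad_def blinfun.scaleR_right
            blinfun.scaleR_left distrib_left power2_eq_square)
    qed
    show "continuous_on (subdiff_domain ?v ?D) ?v'"
      unfolding scaled_proxy_grad_def
      by (intro continuous_intros continuous_on_compose2[OF \<theta>'_continuous])
        (use subdiff_domain_scaled_proxy in auto)
    show "(nrm (x - y))\<^sup>2 \<le> (?v' x - ?v' y) (x - y)"
      if "x \<in> subdiff_domain ?v ?D" "y \<in> subdiff_domain ?v ?D" for x y
    proof -
      define u where "u = ?s x - ?s y"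
      have xy: "x - y = R *\<^sub>R u" using R_pos by (simp add: u_def algebra_simps)
      have "R\<^sup>2 * (nrm u)\<^sup>2 \<le> R\<^sup>2 * (\<theta>' (?s x) - \<theta>' (?s y)) u"
        unfolding u_def
        using that by (intro mult_left_mono \<theta>'_strongly_monotone subdiff_domain_scaled_proxy) auto
      also have "\<dots> = (?v' x - ?v' y) (x - y)"
        unfolding xy scaled_proxy_grad_def
        by (simp add: blinfun.scaleR_right blinfun.scaleR_left power2_eq_square
            flip: scaleR_right_diff_distrib)
      finally show ?thesis
        unfolding xy by (simp add: nrm_scaleR power_mult_distrib)
    qed
    show "convex X" "compact X" by (rule X)+
    show "X \<subseteq> ?D" using R_bound by auto
    show "X \<inter> interior ?D \<noteq> {}" using x0 x0_in_interior_proxy_domain by auto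
  qed
qed

context rsmd_setting
begin

lemma x0_in_Dom: "x0 \<in> Dom"
  using x0_in_interior_proxy_domain interior_subset_subdiff_domain[OF v_convex] by blast

lemma proxy_bounds:
  "bdd_above (\<theta> ` unit_ball nrm)" "bdd_below (\<theta> ` unit_ball nrm)"
  using compact_imp_bounded[OF compact_continuous_image[OF \<theta>(1) compact_unit_ball]]
  by (auto intro: bounded_imp_bdd_above bounded_imp_bdd_below)

lemma proxy_diff_le_range:
  assumes "x \<in> unit_ball nrm" "y \<in> unit_ball nrm"
  shows "\<theta> x - \<theta> y \<le> proxy_range nrm \<theta>"
  unfolding proxy_range_def
  by (intro diff_mono cSUP_upper cINF_lower proxy_bounds assms)

lemma x0_minimizes_proxy:
  assumes "x \<in> proxy_domain"
  shows "scaled_proxy \<theta> x0 R x0 \<le> scaled_proxy \<theta> x0 R x"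
  using \<theta>_argmin in_proxy_domain_iff[OF nrm, of x] assms
  by (auto simp: is_arg_min_linorder scaled_proxy_def intro!: mult_left_mono)

lemma bregman_x0_le:
  assumes "u \<in> X"
  shows "V x0 u \<le> R\<^sup>2 * proxy_range nrm \<theta>"
proof -
  have "V x0 u \<le> scaled_proxy \<theta> x0 R u - scaled_proxy \<theta> x0 R x0"
    using x0 assms x0_minimizes_proxy X_subset by (intro bregman_le_at_minimizer) auto
  also have "\<dots> = R\<^sup>2 * (\<theta> ((u - x0) /\<^sub>R R) - \<theta> 0)"
    by (simp add: scaled_proxy_def right_diff_distrib)
  also have "\<dots> \<le> R\<^sup>2 * proxy_range nrm \<theta>"
    using in_proxy_domain_iff[OF nrm, of u] X_subset assms
    by (intro mult_left_mono proxy_diff_le_range) auto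
  finally show ?thesis .
qed

text \<open>
A vector \<open>y\<close> of length \<open>R\<close>, with sign chosen so that \<open>\<vartheta>'\<close> at the centre is nonnegative on it, is a displacement
along which strong convexity makes the proxy exceed its minimum by at least \<open>R\<^sup>2 / 2\<close>.
\<close>

lemma proxy_range_pos: "0 < proxy_range nrm \<theta>"
proof -
  have "(UNIV :: 'e set) \<noteq> {0}" by (metis UNIV_I nonempty_Basis nonzero_Basis ex_in_conv singletonD)
  then obtain d :: 'e where "d \<noteq> 0" by auto
  define e where "e = (R / nrm d) *\<^sub>R d"
  have nd: "0 < nrm d" using \<open>d \<noteq> 0\<close> nrm_nonneg[of d] nrm_eq_0_iff[of d] by linarith
  have e: "nrm e = R" using nd R_pos \<open>d \<noteq> 0\<close> by (simp add: e_def nrm_scaleR)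
  have "\<exists>y. nrm y = R \<and> 0 \<le> scaled_proxy_grad \<theta>' x0 R x0 y"
  proof (cases "0 \<le> scaled_proxy_grad \<theta>' x0 R x0 e")
    case False
    then show ?thesis using e by (intro exI[of _ "- e"]) (simp add: blinfun.minus_right)
  qed (use e in auto)
  then obtain y where y: "nrm y = R" "0 \<le> scaled_proxy_grad \<theta>' x0 R x0 y" by blast
  have "R\<^sup>2 / 2 \<le> V x0 (x0 + y)"
    using bregman_ge[OF x0_in_Dom, of "x0 + y"] y by simp
  also have "\<dots> \<le> scaled_proxy \<theta> x0 R (x0 + y) - scaled_proxy \<theta> x0 R x0"
    using y(2) by (simp add: bregman_def)
  also have "\<dots> = R\<^sup>2 * (\<theta> (y /\<^sub>R R) - \<theta> 0)"
    by (simp add: scaled_proxy_def right_diff_distrib)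
  also have "\<dots> \<le> R\<^sup>2 * proxy_range nrm \<theta>"
    using in_proxy_domain_iff[OF nrm, of "x0 + y"] y
    by (intro mult_left_mono proxy_diff_le_range) auto
  finally have "0 < R\<^sup>2 * proxy_range nrm \<theta>" using R_pos by (smt (verit) half_gt_zero zero_less_power)
  then show ?thesis using R_pos by (simp add: zero_less_mult_iff)
qed

lemma nrm_diff_le:
  assumes "x \<in> X" "y \<in> X"
  shows "nrm (x - y) \<le> 2 * R"
  using nrm_triangle[of "x - x0" "x0 - y"] R_bound[OF assms(1)] R_bound[OF assms(2)]
  by (simp add: nrm_minus_commute[of x0])

text \<open>
The gradient is a derivative within \<open>X\<close> only, so the tangent inequality is obtained from the one-sided difference
quotients along the segment, which stays in \<open>X\<close>.
\<close>

lemma gradient_inequality: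
  assumes x: "x \<in> X" and y: "y \<in> X"
  shows "\<phi> x + d\<phi> x (y - x) \<le> \<phi> y"
proof -
  let ?p = "\<lambda>t. x + t *\<^sub>R (y - x)"
  have pX: "?p ` {0..1} \<subseteq> X" using segment_in_X[OF x y] by auto
  have "(\<phi> has_derivative d\<phi> x) (at (?p 0) within ?p ` {0..1})"
    using has_derivative_subset[OF \<phi>_deriv[OF x] pX] by simp
  moreover have "(?p has_derivative (\<lambda>t. t *\<^sub>R (y - x))) (at 0 within {0..1})"
    by (auto intro!: derivative_eq_intros)
  ultimately have "((\<lambda>t. \<phi> (?p t)) has_derivative (\<lambda>t. d\<phi> x (t *\<^sub>R (y - x)))) (at 0 within {0..1})"
    by (rule has_derivative_in_compose[rotated])
  then have "((\<lambda>t. \<phi> (?p t)) has_real_derivative d\<phi> x (y - x)) (at 0 within {0..1})"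
    by (simp add: has_field_derivative_def blinfun.scaleR_right mult_commute_abs)
  then have lim: "((\<lambda>t. (\<phi> (?p t) - \<phi> x) / t) \<longlongrightarrow> d\<phi> x (y - x)) (at_right 0)"
    by (simp add: has_field_derivative_iff at_within_Icc_at_right)
  have "d\<phi> x (y - x) \<le> \<phi> y - \<phi> x"
  proof (rule tendsto_upperbound[OF lim])
    have "eventually (\<lambda>t. t \<in> {0<..<1}) (at_right (0::real))"
      by (rule eventually_at_right_real) simp
    then show "eventually (\<lambda>t. (\<phi> (?p t) - \<phi> x) / t \<le> \<phi> y - \<phi> x) (at_right 0)"
    proof eventually_elim
      case (elim t)
      have "\<phi> (?p t) \<le> (1 - t) * \<phi> x + t * \<phi> y"
        using convex_onD[OF \<phi>_convex, of t x y] elim x y by (simp add: algebra_simps)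
      then show ?case using elim by (simp add: field_simps)
    qed
  qed simp
  then show ?thesis by simp
qed

text \<open>
The tangent inequality at the far end of each small step bounds the increments of \<open>\<phi>\<close> along the segment
from above; the Lipschitz condition controls how the slope grows.
\<close>

lemma descent_inequality:
  assumes x: "x \<in> X" and y: "y \<in> X"
  shows "\<phi> y \<le> \<phi> x + d\<phi> x (y - x) + L * (nrm (y - x))\<^sup>2 / 2"
proof -
  let ?p = "\<lambda>t. x + t *\<^sub>R (y - x)"
  have "\<phi> (?p 1) - \<phi> (?p 0) \<le> d\<phi> x (y - x) + L * (nrm (y - x))\<^sup>2 / 2"
  proof (rule increment_le_of_linear_rate)
    fix a b :: real assume ab: "0 \<le> a" "a < b" "b \<le> 1"
    have pX: "?p a \<in> X" "?p b \<in> X" using segment_in_X[OF x y] ab by auto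
    have "(d\<phi> (?p b) - d\<phi> x) (y - x) \<le> dual_norm nrm (d\<phi> (?p b) - d\<phi> x) * nrm (y - x)"
      by (rule apply_le_dual_norm)
    also have "\<dots> \<le> (L * nrm (x - ?p b)) * nrm (y - x)"
      by (intro mult_right_mono d\<phi>_lipschitz x pX) simp
    also have "x - ?p b = - (b *\<^sub>R (y - x))" by simp
    also have "L * nrm (- (b *\<^sub>R (y - x))) * nrm (y - x) = L * (nrm (y - x))\<^sup>2 * b"
      using ab by (simp add: nrm_scaleR power2_eq_square del: scaleR_right_diff_distrib minus_diff_eq)
    finally have *: "d\<phi> (?p b) (y - x) \<le> d\<phi> x (y - x) + L * (nrm (y - x))\<^sup>2 * b"
      by (simp add: blinfun.diff_left)
    have "?p a - ?p b = - ((b - a) *\<^sub>R (y - x))" by (simp add: algebra_simps)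
    then have "\<phi> (?p b) - \<phi> (?p a) \<le> (b - a) * d\<phi> (?p b) (y - x)"
      using gradient_inequality[OF pX(2,1)] by (simp add: blinfun.minus_right blinfun.scaleR_right)
    also have "\<dots> \<le> (b - a) * (d\<phi> x (y - x) + L * (nrm (y - x))\<^sup>2 * b)"
      using * ab by (intro mult_left_mono) auto
    finally show "\<phi> (?p b) - \<phi> (?p a) \<le> (b - a) * (d\<phi> x (y - x) + L * (nrm (y - x))\<^sup>2 * b)" .
  qed
  then show ?thesis by simp
qed

end

section \<open>One run: noise of the truncated oracle and the pathwise bound\<close>

text \<open>
The lower bound \<open>\<lambda> \<ge> M + \<upsilon> \<sigma>\<close> on the truncation level makes the error of the
fallback \<open>gbar\<close> at any feasible point at most \<open>2 \<lambda>\<close>.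
\<close>

locale rsmd_run =
  rsmd_setting P nrm X \<Phi> d\<phi> \<psi> L G \<sigma> xbar gbar \<upsilon> \<theta> \<theta>' x0 R
  for P :: "'w measure" and nrm :: "'e::euclidean_space \<Rightarrow> real"
    and X \<Phi> d\<phi> \<psi> L G \<sigma> xbar gbar \<upsilon> \<theta> \<theta>' x0 R +
  fixes lam \<beta> :: real
  assumes lam_ge: "L * R + \<upsilon> * \<sigma> \<le> lam"
    and \<beta>_pos: "0 < \<beta>"
begin

abbreviation (input) Y :: "'e \<Rightarrow> 'w \<Rightarrow> 'e \<Rightarrow>\<^sub>L real" where
  "Y \<equiv> truncated_oracle nrm L G \<sigma> xbar gbar \<upsilon> lam"

abbreviation (input) iter :: "(nat \<Rightarrow> 'w) \<Rightarrow> nat \<Rightarrow> 'e" where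
  "iter \<equiv> rsmd_iter X \<psi> V (\<lambda>_. \<beta>) Y x0"

definition noise :: "'e \<Rightarrow> 'w \<Rightarrow> 'e \<Rightarrow>\<^sub>L real" where
  "noise x w = Y x w - d\<phi> x"

text \<open>
The fictitious run against which the noise is compared: mirror descent for the losses
\<open>-\<xi>\<^sub>i\<close>, with vanishing \<open>\<psi>\<close>. Like the iterates, its \<open>i\<close>-th point is determined by the first \<open>i\<close> samples.
\<close>

definition ghost :: "(nat \<Rightarrow> 'w) \<Rightarrow> nat \<Rightarrow> 'e" where
  "ghost \<omega> = mirror_iter \<beta> x0 (\<lambda>i. - noise (iter \<omega> (i - 1)) (\<omega> i))"

abbreviation (input) deviation :: "'e \<Rightarrow> 'w \<Rightarrow> real" where
  "deviation x w \<equiv> dual_norm nrm (G x w - d\<phi> x)"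

lemma lam_pos: "0 < lam"
proof -
  have "0 < L * R" using L_pos R_pos by simp
  moreover have "0 \<le> \<upsilon> * \<sigma>" using \<upsilon>_nonneg \<sigma>_pos by simp
  ultimately show ?thesis using lam_ge by linarith
qed

lemma gbar_error:
  assumes x: "x \<in> X"
  shows "dual_norm nrm (gbar - d\<phi> x) \<le> L * nrm (xbar - x) + \<upsilon> * \<sigma>"
proof -
  have "dual_norm nrm (gbar - d\<phi> x)
      \<le> dual_norm nrm (gbar - d\<phi> xbar) + dual_norm nrm (d\<phi> xbar - d\<phi> x)"
    using dual_norm_triangle[of "gbar - d\<phi> xbar" "d\<phi> xbar - d\<phi> x"] by simp
  then show ?thesis
    using gbar d\<phi>_lipschitz[OF x xbar] by (simp add: nrm_minus_commute)
qed

lemma L_nrm_le: "x \<in> X \<Longrightarrow> L * nrm (xbar - x) \<le> 2 * (L * R)"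
  using mult_left_mono[OF nrm_diff_le[OF xbar], of x L] L_pos by simp

lemma gbar_error_le_lam:
  assumes x: "x \<in> X"
  shows "dual_norm nrm (gbar - d\<phi> x) \<le> 2 * lam"
proof -
  have "0 \<le> \<upsilon> * \<sigma>" using \<upsilon>_nonneg \<sigma>_pos by simp
  then show ?thesis using gbar_error[OF x] L_nrm_le[OF x] lam_ge by linarith
qed

text \<open>
The threshold exceeds the error of \<open>gbar\<close> at \<open>x\<close> by at least \<open>\<lambda>\<close>, so a sample is rejected only if it
deviates from the true gradient by more than \<open>\<lambda>\<close>.
\<close>

lemma oracle_cases:
  assumes x: "x \<in> X"
  obtains (accepted) "Y x w = G x w" "dual_norm nrm (G x w - gbar) \<le> L * nrm (xbar - x) + lam + \<upsilon> * \<sigma>"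
  | (rejected) "Y x w = gbar" "lam < deviation x w"
proof (cases "dual_norm nrm (G x w - gbar) \<le> L * nrm (xbar - x) + lam + \<upsilon> * \<sigma>")
  case True
  then show ?thesis by (intro accepted) (simp_all add: truncated_oracle_def)
next
  case False
  have "dual_norm nrm (G x w - gbar) \<le> deviation x w + dual_norm nrm (gbar - d\<phi> x)"
    using dual_norm_triangle[of "G x w - d\<phi> x" "d\<phi> x - gbar"]
    by (simp add: dual_norm_minus_commute[of gbar])
  then show ?thesis
    using False gbar_error[OF x] by (intro rejected) (simp_all add: truncated_oracle_def)
qed

text \<open>
In the rejected case, the error of \<open>gbar\<close> is at most \<open>2 \<lambda>\<close>, less than twice the deviation of the sample. So truncation
at most doubles the noise, and the second moment survives.
\<close>

lemma noise_le_deviation: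
  assumes x: "x \<in> X"
  shows "dual_norm nrm (noise x w) \<le> 2 * deviation x w"
proof (cases rule: oracle_cases[OF x, of w, case_names accepted rejected])
  case accepted
  then show ?thesis by (simp add: noise_def)
next
  case rejected
  then show ?thesis using gbar_error_le_lam[OF x] by (simp add: noise_def)
qed

lemma noise_le:
  assumes x: "x \<in> X"
  shows "dual_norm nrm (noise x w) \<le> 4 * (L * R) + lam + 2 * (\<upsilon> * \<sigma>)"
proof -
  have nn: "0 \<le> \<upsilon> * \<sigma>" "0 < L * R" using \<upsilon>_nonneg \<sigma>_pos L_pos R_pos by simp_all
  show ?thesis
  proof (cases rule: oracle_cases[OF x, of w, case_names accepted rejected])
    case accepted
    have "dual_norm nrm (noise x w) \<le> dual_norm nrm (G x w - gbar) + dual_norm nrm (gbar - d\<phi> x)"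
      using dual_norm_triangle[of "G x w - gbar" "gbar - d\<phi> x"] accepted by (simp add: noise_def)
    then show ?thesis using accepted(2) gbar_error[OF x] L_nrm_le[OF x] by linarith
  next
    case rejected
    then show ?thesis
      using gbar_error[OF x] L_nrm_le[OF x] lam_pos nn by (simp add: noise_def)
  qed
qed

text \<open>
Truncation changes the unbiased noise only after a rejection, and then by at most three
deviations. As the deviation exceeds \<open>\<lambda>\<close> there, one factor \<open>deviation / \<lambda>\<close> can be inserted; in expectation
this bounds the bias by the variance over \<open>\<lambda>\<close>.
\<close>

lemma noise_apply_le:
  assumes x: "x \<in> X"
  shows "noise x w d \<le> (G x w - d\<phi> x) d + 3 / lam * nrm d * (deviation x w)\<^sup>2"
proof (cases rule: oracle_cases[OF x, of w, case_names accepted rejected])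
  case accepted
  then show ?thesis using lam_pos by (simp add: noise_def)
next
  case rejected
  have "dual_norm nrm (gbar - G x w) \<le> 3 * deviation x w"
    using dual_norm_triangle[of "gbar - d\<phi> x" "d\<phi> x - G x w"] gbar_error_le_lam[OF x] rejected(2)
    by (simp add: dual_norm_minus_commute[of "G x w"])
  also have "\<dots> \<le> 3 / lam * (deviation x w)\<^sup>2"
    using rejected(2) lam_pos by (simp add: field_simps power2_eq_square)
  finally have "(gbar - G x w) d \<le> 3 / lam * (deviation x w)\<^sup>2 * nrm d"
    using apply_le_dual_norm[of "gbar - G x w" d] by (meson mult_right_mono nrm_nonneg order_trans)
  then show ?thesis
    using rejected(1) by (simp add: noise_def blinfun.diff_left mult_ac)
qed

lemma continuous_on_d\<phi>: "continuous_on X d\<phi>"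
proof -
  obtain m where m: "0 < m" "\<And>x. nrm x \<le> m * norm x" using norm_dominates_nrm by blast
  obtain k where k: "0 < k" "\<And>s. norm s \<le> k * dual_norm nrm s" using norm_le_dual_norm by blast
  have "(k * (L * m))-lipschitz_on X d\<phi>"
  proof (rule lipschitz_onI)
    fix x y assume xy: "x \<in> X" "y \<in> X"
    have "norm (d\<phi> x - d\<phi> y) \<le> k * dual_norm nrm (d\<phi> x - d\<phi> y)" by (rule k)
    also have "\<dots> \<le> k * (L * (m * norm (y - x)))"
      using k(1) L_pos m(2)
      by (intro mult_left_mono order_trans[OF d\<phi>_lipschitz[OF xy(2,1)]]) auto
    finally show "dist (d\<phi> x) (d\<phi> y) \<le> k * (L * m) * dist x y"
      by (simp add: dist_norm norm_minus_commute mult.assoc)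
  qed (use k m L_pos in auto)
  then show ?thesis by (rule lipschitz_on_continuous_on)
qed

lemma oracle_measurable: "(\<lambda>(x, w). Y x w) \<in> borel_measurable (restrict_space borel X \<Otimes>\<^sub>M P)"
proof -
  note G_measurable[measurable]
  have [measurable]: "(\<lambda>x. nrm (xbar - x)) \<in> borel_measurable (restrict_space borel X)"
    by (intro measurable_restrict_space1 borel_measurable_continuous_onI
        continuous_on_compose2[OF continuous_on_nrm[of UNIV]] continuous_intros) auto
  show ?thesis
    unfolding truncated_oracle_def by (simp add: case_prod_beta') measurable
qed

lemma noise_measurable: "(\<lambda>(x, w). noise x w) \<in> borel_measurable (restrict_space borel X \<Otimes>\<^sub>M P)"
proof -
  note oracle_measurable[measurable]
  have [measurable]: "d\<phi> \<in> borel_measurable (restrict_space borel X)"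
    by (rule borel_measurable_continuous_on_restrict[OF continuous_on_d\<phi>])
  show ?thesis
    unfolding noise_def by (simp add: case_prod_beta') measurable
qed

lemma noise_measurable_at:
  assumes x: "x \<in> X"
  shows "noise x \<in> borel_measurable P"
proof -
  have "(\<lambda>w. (x, w)) \<in> measurable P (restrict_space borel X \<Otimes>\<^sub>M P)"
    using x by (intro measurable_Pair1') (simp add: space_restrict_space)
  from measurable_compose[OF this noise_measurable] show ?thesis by simp
qed

lemma integrable_noise_apply:
  assumes x: "x \<in> X"
  shows "integrable P (\<lambda>w. noise x w d)" "integrable P (\<lambda>w. (noise x w d)\<^sup>2)"
    "integrable P (\<lambda>w. (dual_norm nrm (noise x w))\<^sup>2)"
    "integrable P (\<lambda>w. ((dual_norm nrm (noise x w))\<^sup>2)\<^sup>2)"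
proof -
  note noise_measurable_at[OF x, measurable]
  have app: "(\<lambda>w. noise x w d) \<in> borel_measurable P"
    by (rule measurable_compose[OF noise_measurable_at[OF x]])
      (intro borel_measurable_continuous_onI continuous_intros)
  let ?K = "4 * (L * R) + lam + 2 * (\<upsilon> * \<sigma>)"
  have K: "dual_norm nrm (noise x w) \<le> ?K" for w by (rule noise_le[OF x])
  have Kd: "\<bar>noise x w d\<bar> \<le> ?K * nrm d" for w
    using abs_apply_le_dual_norm[of "noise x w" d] K[of w] mult_right_mono[OF K[of w], of "nrm d"]
    by simp
  show "integrable P (\<lambda>w. noise x w d)"
    using Kd app by (intro integrable_const_bound[where B = "?K * nrm d"]) auto
  have "(noise x w d)\<^sup>2 \<le> (?K * nrm d)\<^sup>2" for w
    using Kd[of w] by (simp add: power2_le_iff_abs_le)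
  then show "integrable P (\<lambda>w. (noise x w d)\<^sup>2)"
    using app by (intro integrable_const_bound[where B = "(?K * nrm d)\<^sup>2"]) auto
  show "integrable P (\<lambda>w. (dual_norm nrm (noise x w))\<^sup>2)"
    using K by (intro integrable_const_bound[where B = "?K\<^sup>2"]) (auto intro!: power_mono)
  show "integrable P (\<lambda>w. ((dual_norm nrm (noise x w))\<^sup>2)\<^sup>2)"
    using K by (intro integrable_const_bound[where B = "(?K\<^sup>2)\<^sup>2"]) (auto intro!: power_mono)
qed

lemma expectation_noise_apply_le:
  assumes x: "x \<in> X"
  shows "(\<integral>w. noise x w d \<partial>P) \<le> 3 * \<sigma>\<^sup>2 / lam * nrm d"
proof -
  have iG: "integrable P (\<lambda>w. G x w - d\<phi> x)" using G_integrable[OF x] by simp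
  have iGd: "integrable P (\<lambda>w. (G x w - d\<phi> x) d)"
    by (rule integrable_bounded_linear[OF blinfun.bounded_linear_left iG])
  have "(\<integral>w. (G x w - d\<phi> x) d \<partial>P) = (\<integral>w. G x w - d\<phi> x \<partial>P) d"
    by (rule integral_bounded_linear[OF blinfun.bounded_linear_left iG])
  also have "\<dots> = 0"
    using G_integrable[OF x] G_unbiased[OF x] by (simp add: prob_space blinfun.zero_left)
  finally have zero: "(\<integral>w. (G x w - d\<phi> x) d \<partial>P) = 0" .
  have "(\<integral>w. noise x w d \<partial>P) \<le> (\<integral>w. (G x w - d\<phi> x) d + 3 / lam * nrm d * (deviation x w)\<^sup>2 \<partial>P)"
    using iGd G_square_integrable[OF x]
    by (intro integral_mono noise_apply_le x integrable_noise_apply) auto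
  also have "\<dots> = 3 / lam * nrm d * (\<integral>w. (deviation x w)\<^sup>2 \<partial>P)"
    using iGd G_square_integrable[OF x] zero by simp
  also have "\<dots> \<le> 3 / lam * nrm d * \<sigma>\<^sup>2"
    using lam_pos by (intro mult_left_mono G_variance x) auto
  finally show ?thesis by (simp add: mult_ac)
qed

lemma expectation_noise_square_le:
  assumes x: "x \<in> X"
  shows "(\<integral>w. (dual_norm nrm (noise x w))\<^sup>2 \<partial>P) \<le> 4 * \<sigma>\<^sup>2"
proof -
  have "(\<integral>w. (dual_norm nrm (noise x w))\<^sup>2 \<partial>P) \<le> (\<integral>w. 4 * (deviation x w)\<^sup>2 \<partial>P)"
  proof (intro integral_mono integrable_noise_apply x)
    show "(dual_norm nrm (noise x w))\<^sup>2 \<le> 4 * (deviation x w)\<^sup>2" for w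
      using power_mono[OF noise_le_deviation[OF x, of w], of 2] by (simp add: power_mult_distrib)
  qed (use G_square_integrable[OF x] in simp)
  also have "\<dots> \<le> 4 * \<sigma>\<^sup>2" using G_variance[OF x] by simp
  finally show ?thesis .
qed

lemma iter_in_X: "iter \<omega> i \<in> X"
  using x0 prox_in_X[OF \<psi> \<beta>_pos] by (cases i) auto

lemma iter_in_Dom: "iter \<omega> i \<in> Dom"
  using x0_in_Dom prox_in_Dom[OF \<psi> \<beta>_pos] by (cases i) auto

lemma ghost_in_X: "ghost \<omega> i \<in> X"
  unfolding ghost_def by (rule mirror_iter_in[OF \<beta>_pos x0 x0_in_Dom])

text \<open>
The three-point inequality with \<open>y\<^sub>i = \<nabla>\<phi>(x\<^sub>i\<^sub>-\<^sub>1) + \<xi>\<^sub>i\<close>, where the noise term is split along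
\<open>z - x\<^sub>i = (z - z\<^sub>i\<^sub>-\<^sub>1) + (z\<^sub>i\<^sub>-\<^sub>1 - x\<^sub>i\<^sub>-\<^sub>1) + (x\<^sub>i\<^sub>-\<^sub>1 - x\<^sub>i)\<close> with the ghost points \<open>z\<^sub>i\<close>. The first part is the
regret of the ghost run, the last costs \<open>\<parallel>\<xi>\<^sub>i\<parallel>\<^sup>2\<close> and a share of the Bregman term of the step, and the
middle one does not involve \<open>z\<close>.
\<close>

lemma gap_le:
  assumes z: "z \<in> X"
  shows "gap d\<phi> \<psi> V (\<lambda>_. \<beta>) N (iter \<omega>) z
    \<le> 2 * V x0 z
      + (\<Sum>i=1..N. noise (iter \<omega> (i - 1)) (\<omega> i) (ghost \<omega> (i - 1) - iter \<omega> (i - 1))) / \<beta>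
      + 3 / (2 * \<beta>\<^sup>2) * (\<Sum>i=1..N. (dual_norm nrm (noise (iter \<omega> (i - 1)) (\<omega> i)))\<^sup>2)"
proof -
  let ?x = "iter \<omega>" and ?g = "ghost \<omega>" and ?n = "\<lambda>i. noise (iter \<omega> (i - 1)) (\<omega> i)"
  let ?S = "\<Sum>i=1..N. (dual_norm nrm (?n i))\<^sup>2"
  have "gap d\<phi> \<psi> V (\<lambda>_. \<beta>) N ?x z
    \<le> (V x0 z - V (?x N) z) + (\<Sum>i=1..N. ?n i (?g (i - 1) - ?x (i - 1))) / \<beta>
      + (\<Sum>i=1..N. (dual_norm nrm (?n i))\<^sup>2) / \<beta>\<^sup>2 + (\<Sum>i=1..N. (- ?n i) (?g (i - 1) - z)) / \<beta>"
  proof (induction N)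
    case 0
    then show ?case by (simp add: gap_def)
  next
    case (Suc N)
    let ?a = "?x N" and ?b = "?x (Suc N)" and ?s = "noise (?x N) (\<omega> (Suc N))"
    have a: "?a \<in> Dom" and b: "?b \<in> proxy_domain"
      using iter_in_Dom iter_in_X X_subset by blast+
    have "Y ?a (\<omega> (Suc N)) (?b - z) + \<psi> ?b - \<psi> z \<le> \<beta> * (V ?a z - V ?b z - V ?a ?b)"
      by (rule prox_three_point[OF \<psi> \<beta>_pos z]) simp
    then have prox_ineq: "Y ?a (\<omega> (Suc N)) (?b - z) + \<psi> ?b - \<psi> z
        \<le> \<beta> * (V ?a z - V ?b z) - \<beta> * V ?a ?b"
      by (simp only: right_diff_distrib)
    have cross: "?s (?a - ?b) \<le> (dual_norm nrm ?s)\<^sup>2 / \<beta> + \<beta> * V ?a ?b / 2"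
    proof -
      have "?s (?a - ?b) \<le> dual_norm nrm ?s * nrm (?b - ?a)"
        using apply_le_dual_norm[of ?s "?a - ?b"] by (simp add: nrm_minus_commute)
      \<comment> \<open>half the modulus \<open>\<beta>\<close>: the other half of the Bregman term belongs to the gap\<close>
      also have "\<dots> \<le> (dual_norm nrm ?s)\<^sup>2 / (2 * (\<beta> / 2)) + \<beta> / 2 * ((nrm (?b - ?a))\<^sup>2 / 2)"
        using \<beta>_pos by (intro young_inequality) simp
      also have "\<beta> / 2 * ((nrm (?b - ?a))\<^sup>2 / 2) \<le> \<beta> / 2 * V ?a ?b"
        using bregman_ge[OF a b] \<beta>_pos by (intro mult_left_mono) auto
      finally show ?thesis by simp
    qed
    have "Y ?a (\<omega> (Suc N)) = d\<phi> ?a + ?s" by (simp add: noise_def)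
    then have "Y ?a (\<omega> (Suc N)) (?b - z) = d\<phi> ?a (?b - z) + ?s (?b - z)"
      by (simp add: blinfun.add_left)
    moreover have "?s (?b - z) = - (- ?s) (?g N - z) - (?s (?g N - ?a) + ?s (?a - ?b))"
      by (simp add: blinfun.diff_right blinfun.minus_left del: rsmd_iter.simps)
    ultimately have "d\<phi> ?a (?b - z) + \<psi> ?b - \<psi> z + \<beta> * V ?a ?b / 2
      \<le> \<beta> * (V ?a z - V ?b z) + ?s (?g N - ?a) + (dual_norm nrm ?s)\<^sup>2 / \<beta> + (- ?s) (?g N - z)"
      using prox_ineq cross by linarith
    then have "(d\<phi> ?a (?b - z) + \<psi> ?b - \<psi> z + \<beta> * V ?a ?b / 2) / \<beta>
      \<le> (\<beta> * (V ?a z - V ?b z) + ?s (?g N - ?a) + (dual_norm nrm ?s)\<^sup>2 / \<beta> + (- ?s) (?g N - z)) / \<beta>"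
      using \<beta>_pos by (intro divide_right_mono) auto
    moreover have "(\<beta> * p + q + r / \<beta> + t) / \<beta> = p + q / \<beta> + r / \<beta>\<^sup>2 + t / \<beta>" for p q r t
      using \<beta>_pos by (simp add: add_divide_distrib power2_eq_square)
    moreover have "(p + \<beta> * q / 2) / \<beta> = inverse \<beta> * p + q / 2" for p q
      using \<beta>_pos by (simp add: field_simps)
    ultimately have "inverse \<beta> * (d\<phi> ?a (?b - z) + \<psi> ?b - \<psi> z) + V ?a ?b / 2
      \<le> (V ?a z - V ?b z) + ?s (?g N - ?a) / \<beta> + (dual_norm nrm ?s)\<^sup>2 / \<beta>\<^sup>2 + (- ?s) (?g N - z) / \<beta>"
      by simp
    then show ?case
      using Suc.IH unfolding gap_def
      by (simp add: add_divide_distrib del: rsmd_iter.simps)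
  qed
  moreover have "(\<Sum>i=1..N. (- ?n i) (?g (i - 1) - z)) / \<beta> \<le> V x0 z + ?S / (2 * \<beta>\<^sup>2)"
  proof -
    have "(\<Sum>i=1..N. (- ?n i) (?g (i - 1) - z)) / \<beta> \<le> (\<beta> * V x0 z + ?S / (2 * \<beta>)) / \<beta>"
      using mirror_iter_regret[OF \<beta>_pos x0 x0_in_Dom z, of "\<lambda>i. - ?n i" N] \<beta>_pos
      unfolding ghost_def by (intro divide_right_mono) auto
    also have "\<dots> = V x0 z + ?S / (2 * \<beta>\<^sup>2)"
      using \<beta>_pos by (simp add: add_divide_distrib power2_eq_square)
    finally show ?thesis .
  qed
  moreover have "0 \<le> V (?x N) z"
    using iter_in_Dom z X_subset by (intro bregman_nonneg) auto
  ultimately have "gap d\<phi> \<psi> V (\<lambda>_. \<beta>) N ?x z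
      \<le> 2 * V x0 z + (\<Sum>i=1..N. ?n i (?g (i - 1) - ?x (i - 1))) / \<beta>
        + (?S / \<beta>\<^sup>2 + ?S / (2 * \<beta>\<^sup>2))"
    by linarith
  also have "?S / \<beta>\<^sup>2 + ?S / (2 * \<beta>\<^sup>2) = 3 / (2 * \<beta>\<^sup>2) * ?S"
    using \<beta>_pos by (simp add: field_simps)
  finally show ?thesis .
qed

text \<open>
By the descent and tangent inequalities, \<open>F(x\<^sub>i) - F(z)\<close> is at most the linearized gap at \<open>x\<^sub>i\<^sub>-\<^sub>1\<close>
plus \<open>L \<parallel>x\<^sub>i - x\<^sub>i\<^sub>-\<^sub>1\<parallel>\<^sup>2 / 2\<close>, and \<open>2 L \<le> \<beta>\<close> lets the half Bregman term of the gap pay for the latter.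
Convexity then passes to the average.
\<close>

lemma optimality_gap_le:
  assumes LB: "2 * L \<le> \<beta>" and N: "1 \<le> N" and z: "z \<in> X"
  shows "\<phi> (weighted_average (\<lambda>_. \<beta>) N (iter \<omega>)) + \<psi> (weighted_average (\<lambda>_. \<beta>) N (iter \<omega>))
      - (\<phi> z + \<psi> z) \<le> \<beta> / real N * gap d\<phi> \<psi> V (\<lambda>_. \<beta>) N (iter \<omega>) z"
proof -
  let ?x = "iter \<omega>" and ?F = "\<lambda>x. \<phi> x + \<psi> x"
  have avg: "weighted_average (\<lambda>_. \<beta>) N ?x = (\<Sum>i=1..N. (1 / real N) *\<^sub>R ?x i)"
    using \<beta>_pos by (simp add: weighted_average_def scaleR_right.sum[symmetric] divide_inverse)
  have "?F (\<Sum>i=1..N. (1 / real N) *\<^sub>R ?x i) \<le> (\<Sum>i=1..N. 1 / real N * ?F (?x i))"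
    using N by (intro convex_on_sum[OF _ _ convex_on_add[OF \<phi>_convex \<psi>(1)]] iter_in_X) auto
  moreover have "1 / real N * (?F (?x i) - ?F z) \<le> \<beta> / real N * (inverse \<beta> *
      (d\<phi> (?x (i - 1)) (?x i - z) + \<psi> (?x i) - \<psi> z) + V (?x (i - 1)) (?x i) / 2)" for i
  proof -
    let ?a = "?x (i - 1)" and ?b = "?x i"
    have aD: "?a \<in> Dom" "?b \<in> proxy_domain" using iter_in_Dom iter_in_X X_subset by blast+
    have "\<phi> ?b \<le> \<phi> ?a + d\<phi> ?a (?b - ?a) + L * (nrm (?b - ?a))\<^sup>2 / 2"
      by (intro descent_inequality iter_in_X)
    moreover have "\<phi> ?a + d\<phi> ?a (z - ?a) \<le> \<phi> z"
      by (intro gradient_inequality iter_in_X z)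
    moreover have "L * (nrm (?b - ?a))\<^sup>2 / 2 \<le> \<beta> * V ?a ?b / 2"
    proof -
      have "2 * L * ((nrm (?b - ?a))\<^sup>2 / 2) \<le> \<beta> * V ?a ?b"
        using LB L_pos \<beta>_pos bregman_ge[OF aD] by (intro mult_mono) auto
      then show ?thesis by simp
    qed
    moreover have "d\<phi> ?a (?b - z) = d\<phi> ?a (?b - ?a) - d\<phi> ?a (z - ?a)"
      by (simp add: blinfun.diff_right)
    ultimately have "?F ?b - ?F z \<le> d\<phi> ?a (?b - z) + \<psi> ?b - \<psi> z + \<beta> * V ?a ?b / 2"
      by linarith
    also have "\<dots> = \<beta> * (inverse \<beta> * (d\<phi> ?a (?b - z) + \<psi> ?b - \<psi> z) + V ?a ?b / 2)"
      using \<beta>_pos by (simp add: distrib_left)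
    finally show ?thesis
      using N by (simp add: divide_right_mono)
  qed
  then have "(\<Sum>i=1..N. 1 / real N * (?F (?x i) - ?F z))
      \<le> \<beta> / real N * gap d\<phi> \<psi> V (\<lambda>_. \<beta>) N ?x z"
    unfolding gap_def sum_distrib_left by (intro sum_mono) auto
  moreover have "(\<Sum>i=1..N. 1 / real N * (?F (?x i) - ?F z))
      = (\<Sum>i=1..N. 1 / real N * ?F (?x i)) - ?F z"
    using N by (simp add: right_diff_distrib sum_subtractf)
  ultimately show ?thesis unfolding avg by linarith
qed

section \<open>The random terms\<close>

lemma ghost_0: "ghost \<omega> 0 = x0"
  and ghost_Suc: "ghost \<omega> (Suc i) =
    prox X (\<lambda>_. 0) V \<beta> (ghost \<omega> i) (- noise (iter \<omega> i) (\<omega> (Suc i)))"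
  by (simp_all add: ghost_def)

lemma iter_update: "i \<le> n \<Longrightarrow> iter (\<omega> (Suc n := w)) i = iter \<omega> i"
  by (induction i) simp_all

lemma ghost_update: "i \<le> n \<Longrightarrow> ghost (\<omega> (Suc n := w)) i = ghost \<omega> i"
  by (induction i) (simp_all add: ghost_0 ghost_Suc iter_update del: rsmd_iter.simps)

text \<open>
Measurability of the proxy gradient at the current point is carried along with that of the point
itself: the next step is a continuous function of it and of the oracle answer, and so is the proxy
gradient at the next point. This avoids any question whether the domain of the subdifferential is a Borel set.
\<close>

lemma prox_measurable:
  assumes \<psi>': "convex_on X \<psi>'" "continuous_on X \<psi>'"
    and x: "(\<lambda>\<omega>. scaled_proxy_grad \<theta>' x0 R (x \<omega>)) \<in> borel_measurable S"
    and g: "g \<in> borel_measurable S"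
  shows "(\<lambda>\<omega>. prox X \<psi>' V \<beta> (x \<omega>) (g \<omega>)) \<in> measurable S (restrict_space borel X)"
    and "(\<lambda>\<omega>. scaled_proxy_grad \<theta>' x0 R (prox X \<psi>' V \<beta> (x \<omega>) (g \<omega>))) \<in> borel_measurable S"
proof -
  have eta: "(\<lambda>\<omega>. g \<omega> - \<beta> *\<^sub>R scaled_proxy_grad \<theta>' x0 R (x \<omega>)) \<in> borel_measurable S"
    using x g by measurable
  show "(\<lambda>\<omega>. prox X \<psi>' V \<beta> (x \<omega>) (g \<omega>)) \<in> measurable S (restrict_space borel X)"
  proof (rule measurable_restrict_space2)
    show "(\<lambda>\<omega>. prox X \<psi>' V \<beta> (x \<omega>) (g \<omega>)) \<in> borel_measurable S"
      unfolding prox_eq_mirror_map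
      by (rule measurable_compose[OF eta])
        (intro borel_measurable_continuous_onI continuous_on_mirror_map \<psi>' \<beta>_pos)
  qed (use prox_in_X[OF \<psi>' \<beta>_pos] in auto)
  show "(\<lambda>\<omega>. scaled_proxy_grad \<theta>' x0 R (prox X \<psi>' V \<beta> (x \<omega>) (g \<omega>))) \<in> borel_measurable S"
    unfolding prox_eq_mirror_map
    by (rule measurable_compose[OF eta])
      (intro borel_measurable_continuous_onI continuous_on_v'_mirror_map \<psi>' \<beta>_pos)
qed

lemma iter_measurable:
  assumes "k \<le> n"
  shows "(\<lambda>\<omega>. iter \<omega> k) \<in> measurable (\<Pi>\<^sub>M i\<in>{1..n}. P) (restrict_space borel X)"
    and "(\<lambda>\<omega>. scaled_proxy_grad \<theta>' x0 R (iter \<omega> k)) \<in> borel_measurable (\<Pi>\<^sub>M i\<in>{1..n}. P)"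
proof -
  have "(\<lambda>\<omega>. iter \<omega> k) \<in> measurable (\<Pi>\<^sub>M i\<in>{1..n}. P) (restrict_space borel X) \<and>
      (\<lambda>\<omega>. scaled_proxy_grad \<theta>' x0 R (iter \<omega> k)) \<in> borel_measurable (\<Pi>\<^sub>M i\<in>{1..n}. P)"
    using assms
  proof (induction k)
    case 0
    then show ?case using x0 by (simp add: space_restrict_space)
  next
    case (Suc k)
    have "(\<lambda>\<omega>. (iter \<omega> k, \<omega> (Suc k))) \<in>
        measurable (\<Pi>\<^sub>M i\<in>{1..n}. P) (restrict_space borel X \<Otimes>\<^sub>M P)"
      using Suc by (intro measurable_Pair measurable_component_singleton) auto
    from measurable_compose[OF this oracle_measurable]
    have "(\<lambda>\<omega>. Y (iter \<omega> k) (\<omega> (Suc k))) \<in> borel_measurable (\<Pi>\<^sub>M i\<in>{1..n}. P)"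
      by simp
    then show ?case
      using Suc prox_measurable[OF \<psi>, of "\<lambda>\<omega>. iter \<omega> k"] by simp
  qed
  then show "(\<lambda>\<omega>. iter \<omega> k) \<in> measurable (\<Pi>\<^sub>M i\<in>{1..n}. P) (restrict_space borel X)"
    and "(\<lambda>\<omega>. scaled_proxy_grad \<theta>' x0 R (iter \<omega> k)) \<in> borel_measurable (\<Pi>\<^sub>M i\<in>{1..n}. P)"
    by auto
qed

lemma noise_along_iter_measurable:
  assumes "Suc k \<le> n"
  shows "(\<lambda>\<omega>. noise (iter \<omega> k) (\<omega> (Suc k))) \<in> borel_measurable (\<Pi>\<^sub>M i\<in>{1..n}. P)"
proof -
  have "(\<lambda>\<omega>. (iter \<omega> k, \<omega> (Suc k))) \<in>
      measurable (\<Pi>\<^sub>M i\<in>{1..n}. P) (restrict_space borel X \<Otimes>\<^sub>M P)"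
    using assms by (intro measurable_Pair measurable_component_singleton iter_measurable) auto
  from measurable_compose[OF this noise_measurable] show ?thesis by simp
qed

lemma ghost_measurable:
  assumes "k \<le> n"
  shows "(\<lambda>\<omega>. ghost \<omega> k) \<in> measurable (\<Pi>\<^sub>M i\<in>{1..n}. P) (restrict_space borel X)"
proof -
  have "(\<lambda>\<omega>. ghost \<omega> k) \<in> measurable (\<Pi>\<^sub>M i\<in>{1..n}. P) (restrict_space borel X) \<and>
      (\<lambda>\<omega>. scaled_proxy_grad \<theta>' x0 R (ghost \<omega> k)) \<in> borel_measurable (\<Pi>\<^sub>M i\<in>{1..n}. P)"
    using assms
  proof (induction k)
    case 0
    then show ?case using x0 by (simp add: ghost_0 space_restrict_space)
  next
    case (Suc k)
    have "(\<lambda>\<omega>. - noise (iter \<omega> k) (\<omega> (Suc k))) \<in> borel_measurable (\<Pi>\<^sub>M i\<in>{1..n}. P)"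
      using noise_along_iter_measurable[OF Suc.prems] by measurable
    then show ?case
      using Suc prox_measurable[OF zero_admissible, of "\<lambda>\<omega>. ghost \<omega> k"] by (simp add: ghost_Suc)
  qed
  then show ?thesis by blast
qed

text \<open>
The linear noise terms that \<open>gap_le\<close> leaves. Without the bias caused by truncation they would be martingale
differences, because the ghost point and the iterate are determined by the earlier samples.
\<close>

definition drift :: "nat \<Rightarrow> (nat \<Rightarrow> 'w) \<Rightarrow> real" where
  "drift k \<omega> = noise (iter \<omega> (k - 1)) (\<omega> k) (ghost \<omega> (k - 1) - iter \<omega> (k - 1))"

definition noise_square :: "nat \<Rightarrow> (nat \<Rightarrow> 'w) \<Rightarrow> real" where
  "noise_square k \<omega> = (dual_norm nrm (noise (iter \<omega> (k - 1)) (\<omega> k)))\<^sup>2"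

lemma drift_measurable:
  assumes "1 \<le> k" "k \<le> n"
  shows "drift k \<in> borel_measurable (\<Pi>\<^sub>M i\<in>{1..n}. P)"
proof -
  have "(\<lambda>\<omega>. noise (iter \<omega> (k - 1)) (\<omega> k)) \<in> borel_measurable (\<Pi>\<^sub>M i\<in>{1..n}. P)"
    using noise_along_iter_measurable[of "k - 1" n] assms by simp
  moreover have "(\<lambda>\<omega>. ghost \<omega> (k - 1)) \<in> borel_measurable (\<Pi>\<^sub>M i\<in>{1..n}. P)"
    by (rule measurable_restrict_space2_iff[THEN iffD1, THEN conjunct1, OF ghost_measurable])
      (use assms in simp)
  moreover have "(\<lambda>\<omega>. iter \<omega> (k - 1)) \<in> borel_measurable (\<Pi>\<^sub>M i\<in>{1..n}. P)"
    by (rule measurable_restrict_space2_iff[THEN iffD1, THEN conjunct1, OF iter_measurable(1)])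
      (use assms in simp)
  ultimately show ?thesis
    unfolding drift_def
    by (intro borel_measurable_continuous_Pair[where H = blinfun_apply] borel_measurable_diff
        continuous_intros)
qed

lemma noise_square_measurable:
  assumes "1 \<le> k" "k \<le> n"
  shows "noise_square k \<in> borel_measurable (\<Pi>\<^sub>M i\<in>{1..n}. P)"
proof -
  have [measurable]: "(\<lambda>\<omega>. noise (iter \<omega> (k - 1)) (\<omega> k)) \<in> borel_measurable (\<Pi>\<^sub>M i\<in>{1..n}. P)"
    using noise_along_iter_measurable[of "k - 1" n] assms by simp
  show ?thesis unfolding noise_square_def by measurable
qed

lemma drift_update: "k \<le> n \<Longrightarrow> drift k (\<omega> (Suc n := w)) = drift k \<omega>"
  and drift_new: "drift (Suc n) (\<omega> (Suc n := w)) = noise (iter \<omega> n) w (ghost \<omega> n - iter \<omega> n)"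
  and noise_square_update: "k \<le> n \<Longrightarrow> noise_square k (\<omega> (Suc n := w)) = noise_square k \<omega>"
  and noise_square_new: "noise_square (Suc n) (\<omega> (Suc n := w)) = (dual_norm nrm (noise (iter \<omega> n) w))\<^sup>2"
  by (simp_all add: drift_def noise_square_def iter_update ghost_update)

context
  fixes b :: real
  assumes b: "0 < b" "\<And>x w. x \<in> X \<Longrightarrow> dual_norm nrm (noise x w) \<le> b"
begin

text \<open>
A summand is at most \<open>2 R b\<close>, its conditional mean is at most \<open>3 \<sigma>\<^sup>2 / \<lambda> \<cdot> 2 R\<close> and its second moment at
most \<open>(2 R)\<^sup>2 \<cdot> 4 \<sigma>\<^sup>2\<close>, as the iterates and the ghost points are at most \<open>2 R\<close> apart.
\<close>

lemma drift_tail: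
  "\<P>(\<omega> in \<Pi>\<^sub>M i\<in>{1..n}. P.
      real n * (6 * R * \<sigma>\<^sup>2 / lam + 8 * R * \<sigma>\<^sup>2 / b) + 2 * R * b * \<tau> \<le> (\<Sum>k=1..n. drift k \<omega>))
    \<le> exp (- \<tau>)"
proof -
  have diam: "nrm (ghost \<omega> m - iter \<omega> m) \<le> 2 * R" for \<omega> m
    by (intro nrm_diff_le ghost_in_X iter_in_X)
  have abs: "\<bar>noise (iter \<omega> m) w (ghost \<omega> m - iter \<omega> m)\<bar>
      \<le> dual_norm nrm (noise (iter \<omega> m) w) * (2 * R)" for \<omega> m w
    by (rule order_trans[OF abs_apply_le_dual_norm]) (intro mult_left_mono diam; simp)
  have "\<P>(\<omega> in \<Pi>\<^sub>M i\<in>{1..n}. P.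
      real n * (6 * R * \<sigma>\<^sup>2 / lam + 16 * R\<^sup>2 * \<sigma>\<^sup>2 / (2 * R * b)) + 2 * R * b * \<tau> \<le> (\<Sum>k=1..n. drift k \<omega>))
    \<le> exp (- \<tau>)"
  proof (rule adapted_sum_tail)
    show "0 < 2 * R * b" using b R_pos by simp
    fix m \<omega>
    show "drift (Suc m) (\<omega> (Suc m := w)) \<le> 2 * R * b" for w
    proof -
      have "dual_norm nrm (noise (iter \<omega> m) w) * (2 * R) \<le> b * (2 * R)"
        using R_pos by (intro mult_right_mono b iter_in_X) simp
      then show ?thesis using abs[of \<omega> m w] by (simp add: drift_new mult_ac)
    qed
    show "(\<integral>w. drift (Suc m) (\<omega> (Suc m := w)) \<partial>P) \<le> 6 * R * \<sigma>\<^sup>2 / lam"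
    proof -
      have "(\<integral>w. drift (Suc m) (\<omega> (Suc m := w)) \<partial>P)
          \<le> 3 * \<sigma>\<^sup>2 / lam * nrm (ghost \<omega> m - iter \<omega> m)"
        unfolding drift_new by (intro expectation_noise_apply_le iter_in_X)
      also have "\<dots> \<le> 3 * \<sigma>\<^sup>2 / lam * (2 * R)"
        using lam_pos by (intro mult_left_mono diam) simp
      finally show ?thesis by (simp add: mult_ac)
    qed
    show "(\<integral>w. (drift (Suc m) (\<omega> (Suc m := w)))\<^sup>2 \<partial>P) \<le> 16 * R\<^sup>2 * \<sigma>\<^sup>2"
    proof -
      have "(\<integral>w. (drift (Suc m) (\<omega> (Suc m := w)))\<^sup>2 \<partial>P)
          \<le> (\<integral>w. 4 * R\<^sup>2 * (dual_norm nrm (noise (iter \<omega> m) w))\<^sup>2 \<partial>P)"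
        unfolding drift_new
      proof (intro integral_mono integrable_noise_apply iter_in_X)
        show "(noise (iter \<omega> m) w (ghost \<omega> m - iter \<omega> m))\<^sup>2
            \<le> 4 * R\<^sup>2 * (dual_norm nrm (noise (iter \<omega> m) w))\<^sup>2" for w
          using power_mono[OF abs[of \<omega> m w] abs_ge_zero, of 2]
          by (simp add: power_mult_distrib mult_ac)
      qed (simp add: integrable_noise_apply iter_in_X)
      also have "\<dots> = 4 * R\<^sup>2 * (\<integral>w. (dual_norm nrm (noise (iter \<omega> m) w))\<^sup>2 \<partial>P)"
        by (rule integral_mult_right_zero)
      also have "\<dots> \<le> 4 * R\<^sup>2 * (4 * \<sigma>\<^sup>2)"
        by (intro mult_left_mono expectation_noise_square_le iter_in_X) simp
      finally show ?thesis by simp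
    qed
    show "integrable P (\<lambda>w. drift (Suc m) (\<omega> (Suc m := w)))"
      "integrable P (\<lambda>w. (drift (Suc m) (\<omega> (Suc m := w)))\<^sup>2)"
      unfolding drift_new by (intro integrable_noise_apply iter_in_X)+
  qed (rule drift_measurable drift_update; assumption)+
  moreover have "16 * R\<^sup>2 * \<sigma>\<^sup>2 / (2 * R * b) = 8 * R * \<sigma>\<^sup>2 / b"
    using R_pos b by (simp add: field_simps power2_eq_square)
  ultimately show ?thesis by simp
qed

text \<open>
The bound \<open>b\<^sup>2\<close> on a summand also bounds its second moment by \<open>b\<^sup>2\<close> times its mean, so mean and
second moment contribute \<open>4 \<sigma>\<^sup>2\<close> each.
\<close>

lemma noise_square_tail:
  "\<P>(\<omega> in \<Pi>\<^sub>M i\<in>{1..n}. P.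
      real n * (8 * \<sigma>\<^sup>2) + b\<^sup>2 * \<tau> \<le> (\<Sum>k=1..n. noise_square k \<omega>)) \<le> exp (- \<tau>)"
proof -
  have bound: "(dual_norm nrm (noise (iter \<omega> m) w))\<^sup>2 \<le> b\<^sup>2" for \<omega> m w
    by (intro power_mono b iter_in_X) simp
  have "\<P>(\<omega> in \<Pi>\<^sub>M i\<in>{1..n}. P.
      real n * (4 * \<sigma>\<^sup>2 + b\<^sup>2 * (4 * \<sigma>\<^sup>2) / b\<^sup>2) + b\<^sup>2 * \<tau> \<le> (\<Sum>k=1..n. noise_square k \<omega>))
    \<le> exp (- \<tau>)"
  proof (rule adapted_sum_tail)
    fix m \<omega>
    show "(\<integral>w. noise_square (Suc m) (\<omega> (Suc m := w)) \<partial>P) \<le> 4 * \<sigma>\<^sup>2"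
      unfolding noise_square_new by (intro expectation_noise_square_le iter_in_X)
    show "(\<integral>w. (noise_square (Suc m) (\<omega> (Suc m := w)))\<^sup>2 \<partial>P) \<le> b\<^sup>2 * (4 * \<sigma>\<^sup>2)"
    proof -
      have "(\<integral>w. (noise_square (Suc m) (\<omega> (Suc m := w)))\<^sup>2 \<partial>P)
          \<le> (\<integral>w. b\<^sup>2 * (dual_norm nrm (noise (iter \<omega> m) w))\<^sup>2 \<partial>P)"
        unfolding noise_square_new
      proof (intro integral_mono integrable_noise_apply iter_in_X)
        show "((dual_norm nrm (noise (iter \<omega> m) w))\<^sup>2)\<^sup>2
            \<le> b\<^sup>2 * (dual_norm nrm (noise (iter \<omega> m) w))\<^sup>2" for w
          unfolding power2_eq_square[of "(dual_norm nrm (noise (iter \<omega> m) w))\<^sup>2"]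
          by (intro mult_right_mono bound) simp
      qed (simp add: integrable_noise_apply iter_in_X)
      also have "\<dots> = b\<^sup>2 * (\<integral>w. (dual_norm nrm (noise (iter \<omega> m) w))\<^sup>2 \<partial>P)"
        by (rule integral_mult_right_zero)
      also have "\<dots> \<le> b\<^sup>2 * (4 * \<sigma>\<^sup>2)"
        by (intro mult_left_mono expectation_noise_square_le iter_in_X) simp
      finally show ?thesis .
    qed
    show "noise_square (Suc m) (\<omega> (Suc m := w)) \<le> b\<^sup>2" for w
      unfolding noise_square_new by (rule bound)
    show "integrable P (\<lambda>w. noise_square (Suc m) (\<omega> (Suc m := w)))"
      "integrable P (\<lambda>w. (noise_square (Suc m) (\<omega> (Suc m := w)))\<^sup>2)"
      unfolding noise_square_new by (intro integrable_noise_apply iter_in_X)+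
    show "0 < b\<^sup>2" using b(1) by simp
  qed (rule noise_square_measurable noise_square_update; assumption)+
  then show ?thesis using b(1) by simp
qed

lemma high_probability_event:
  shows "\<exists>A\<in>sets (\<Pi>\<^sub>M i\<in>{1..n}. P). 1 - 2 * exp (- \<tau>) \<le> measure (\<Pi>\<^sub>M i\<in>{1..n}. P) A \<and>
    (\<forall>\<omega>\<in>A. (\<Sum>k=1..n. drift k \<omega>) \<le> real n * (6 * R * \<sigma>\<^sup>2 / lam + 8 * R * \<sigma>\<^sup>2 / b) + 2 * R * b * \<tau> \<and>
      (\<Sum>k=1..n. noise_square k \<omega>) \<le> real n * (8 * \<sigma>\<^sup>2) + b\<^sup>2 * \<tau>)"
proof -
  let ?PN = "\<Pi>\<^sub>M i\<in>{1..n}. P"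
  interpret PN: prob_space ?PN by (intro prob_space_PiM) unfold_locales
  let ?t = "real n * (6 * R * \<sigma>\<^sup>2 / lam + 8 * R * \<sigma>\<^sup>2 / b) + 2 * R * b * \<tau>"
  let ?q = "real n * (8 * \<sigma>\<^sup>2) + b\<^sup>2 * \<tau>"
  let ?B1 = "{\<omega> \<in> space ?PN. ?t \<le> (\<Sum>k=1..n. drift k \<omega>)}"
  let ?B2 = "{\<omega> \<in> space ?PN. ?q \<le> (\<Sum>k=1..n. noise_square k \<omega>)}"
  have "(\<lambda>\<omega>. \<Sum>k=1..n. drift k \<omega>) \<in> borel_measurable ?PN"
    "(\<lambda>\<omega>. \<Sum>k=1..n. noise_square k \<omega>) \<in> borel_measurable ?PN"
    by (intro borel_measurable_sum drift_measurable noise_square_measurable; simp)+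
  then have B: "?B1 \<in> sets ?PN" "?B2 \<in> sets ?PN" by (intro borel_measurable_le; simp)+
  have "measure ?PN (?B1 \<union> ?B2) \<le> 2 * exp (- \<tau>)"
    using measure_Un_le[OF B] drift_tail[of n \<tau>] noise_square_tail[of n \<tau>] by linarith
  then have "1 - 2 * exp (- \<tau>) \<le> measure ?PN (space ?PN - (?B1 \<union> ?B2))"
    using PN.prob_compl[OF sets.Un[OF B]] by linarith
  moreover have "space ?PN - (?B1 \<union> ?B2) \<in> sets ?PN"
    by (intro sets.compl_sets sets.Un B)
  moreover have "(\<Sum>k=1..n. drift k \<omega>) \<le> ?t" "(\<Sum>k=1..n. noise_square k \<omega>) \<le> ?q"
    if "\<omega> \<in> space ?PN - (?B1 \<union> ?B2)" for \<omega>
  proof -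
    have "\<not> ?t \<le> (\<Sum>k=1..n. drift k \<omega>)" "\<not> ?q \<le> (\<Sum>k=1..n. noise_square k \<omega>)"
      using that by blast+
    then show "(\<Sum>k=1..n. drift k \<omega>) \<le> ?t" "(\<Sum>k=1..n. noise_square k \<omega>) \<le> ?q"
      by linarith+
  qed
  ultimately show ?thesis by blast
qed

end

end

section \<open>Choice of parameters and the theorem\<close>

text \<open>
The level \<open>\<Lambda>\<close> balances the bias, of order \<open>n \<sigma>\<^sup>2 / \<Lambda>\<close>, against the range term \<open>\<Lambda> \<tau>\<close> of the tail
bound; both have the order \<open>\<sigma> \<surd>(\<tau> n)\<close> when \<open>\<Lambda> = \<sigma> \<surd>(n / \<tau>)\<close>.
\<close>

lemma truncation_level_bounds:
  fixes \<sigma> n \<tau> M \<Lambda> :: real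
  assumes "0 < \<sigma>" "0 < n" "0 < \<tau>" "0 < M" and \<Lambda>: "\<Lambda> = max (\<sigma> * sqrt (n / \<tau>)) M"
  shows "n * \<sigma>\<^sup>2 / \<Lambda> \<le> max (\<sigma> * sqrt (\<tau> * n)) (M * \<tau>)"
    and "\<Lambda> * \<tau> = max (\<sigma> * sqrt (\<tau> * n)) (M * \<tau>)"
    and "\<Lambda>\<^sup>2 * \<tau> \<le> max (n * \<sigma>\<^sup>2) (M\<^sup>2 * \<tau>)"
proof -
  have pos: "0 < \<Lambda>" using assms by (simp add: less_max_iff_disj)
  have r: "sqrt (n / \<tau>) * sqrt (\<tau> * n) = n" "sqrt (n / \<tau>) * \<tau> = sqrt (\<tau> * n)"
  proof -
    have "sqrt (n / \<tau>) * sqrt (\<tau> * n) = sqrt (n\<^sup>2)"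
      using assms by (simp add: power2_eq_square flip: real_sqrt_mult)
    then show "sqrt (n / \<tau>) * sqrt (\<tau> * n) = n" using assms by simp
    have "sqrt (n / \<tau>) * \<tau> = sqrt n / sqrt \<tau> * (sqrt \<tau> * sqrt \<tau>)"
      using assms by (simp add: real_sqrt_divide)
    also have "\<dots> = sqrt (\<tau> * n)"
      using assms by (simp add: real_sqrt_mult del: real_sqrt_mult_self)
    finally show "sqrt (n / \<tau>) * \<tau> = sqrt (\<tau> * n)" .
  qed
  have "n * \<sigma>\<^sup>2 = (\<sigma> * sqrt (\<tau> * n)) * (\<sigma> * sqrt (n / \<tau>))"
    using r(1) by (simp add: power2_eq_square mult_ac)
  also have "\<dots> \<le> (\<sigma> * sqrt (\<tau> * n)) * \<Lambda>"
    using assms by (intro mult_left_mono) auto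
  finally show "n * \<sigma>\<^sup>2 / \<Lambda> \<le> max (\<sigma> * sqrt (\<tau> * n)) (M * \<tau>)"
    using pos by (simp add: pos_divide_le_eq le_max_iff_disj)
  show "\<Lambda> * \<tau> = max (\<sigma> * sqrt (\<tau> * n)) (M * \<tau>)"
    using assms r(2) by (simp add: max_mult_distrib_right mult.assoc)
  show "\<Lambda>\<^sup>2 * \<tau> \<le> max (n * \<sigma>\<^sup>2) (M\<^sup>2 * \<tau>)"
  proof (cases "\<Lambda> = M")
    case False
    then have "\<Lambda> = \<sigma> * sqrt (n / \<tau>)" using \<Lambda> by linarith
    then have "\<Lambda>\<^sup>2 * \<tau> = n * \<sigma>\<^sup>2" using assms by (simp add: power_mult_distrib)
    then show ?thesis by simp
  qed simp
qed

text \<open>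
Each of the three terms is bounded by the maximum of \<open>a = L R\<^sup>2 max {\<tau>, \<Theta>}\<close> and
\<open>b = \<sigma> R \<surd>(n max {\<tau>, \<Theta>})\<close>, except that the first one may be as large as \<open>2 a\<close>; this gives the factor \<open>4\<close>.
\<close>

lemma step_size_tradeoff:
  fixes L R \<sigma> \<Theta> n \<tau> \<beta> :: real
  assumes pos: "0 < L" "0 < R" "0 < \<sigma>" "0 < \<Theta>" "0 < n" "0 < \<tau>"
    and \<beta>: "\<beta> = max (2 * L) (\<sigma> * sqrt n / (R * sqrt \<Theta>))"
  shows "(\<beta> * R\<^sup>2 * \<Theta> + R * max (\<sigma> * sqrt (\<tau> * n)) (L * R * \<tau>)
      + inverse \<beta> * max (n * \<sigma>\<^sup>2) ((L * R)\<^sup>2 * \<tau>)) / n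
    \<le> 4 * max (L * R\<^sup>2 * max \<tau> \<Theta> / n) (\<sigma> * R * sqrt (max \<tau> \<Theta> / n))"
proof -
  define T where "T = max \<tau> \<Theta>"
  define a where "a = L * R\<^sup>2 * T"
  define b where "b = \<sigma> * R * sqrt (n * T)"
  have T: "\<tau> \<le> T" "\<Theta> \<le> T" "0 < T" using pos by (auto simp: T_def)
  have a: "0 < a" using pos T by (simp add: a_def)
  have b: "0 < b" using pos T by (simp add: b_def)
  have \<beta>_pos: "0 < \<beta>" and \<beta>_ge: "2 * L \<le> \<beta>" "\<sigma> * sqrt n / (R * sqrt \<Theta>) \<le> \<beta>"
    using pos by (auto simp: \<beta> less_max_iff_disj)
  have "\<beta> * R\<^sup>2 * \<Theta> \<le> max (2 * a) b"
  proof (cases "\<beta> = 2 * L")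
    case True
    then have "\<beta> * R\<^sup>2 * \<Theta> \<le> 2 * a" using pos T by (simp add: a_def mult_left_mono)
    then show ?thesis by simp
  next
    case False
    then have \<beta>_eq: "\<beta> = \<sigma> * sqrt n / (R * sqrt \<Theta>)" using \<beta> by linarith
    define q where "q = sqrt \<Theta>"
    have q: "0 < q" using pos by (simp add: q_def)
    have "\<beta> * R\<^sup>2 * \<Theta> = \<sigma> * sqrt n / (R * q) * R\<^sup>2 * q\<^sup>2"
      using pos by (simp add: \<beta>_eq q_def)
    also have "\<dots> = \<sigma> * R * (sqrt n * q)"
      using pos q by (simp add: power2_eq_square)
    also have "\<dots> \<le> b"
      using pos T unfolding b_def real_sqrt_mult q_def by (intro mult_left_mono) auto
    finally show ?thesis by simp
  qed
  moreover have "R * max (\<sigma> * sqrt (\<tau> * n)) (L * R * \<tau>) \<le> max a b"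
  proof -
    have "R * (\<sigma> * sqrt (\<tau> * n)) = \<sigma> * R * sqrt (n * \<tau>)" by (simp add: mult_ac)
    also have "\<dots> \<le> b"
      using pos T unfolding b_def by (intro mult_left_mono) auto
    finally have 1: "R * (\<sigma> * sqrt (\<tau> * n)) \<le> b" .
    have "R * (L * R * \<tau>) = L * R\<^sup>2 * \<tau>" by (simp add: power2_eq_square)
    also have "\<dots> \<le> a"
      using pos T unfolding a_def by (intro mult_left_mono) auto
    finally have 2: "R * (L * R * \<tau>) \<le> a" .
    show ?thesis using 1 2 by (simp add: max_def)
  qed
  moreover have "inverse \<beta> * max (n * \<sigma>\<^sup>2) ((L * R)\<^sup>2 * \<tau>) \<le> max a b"
  proof -
    have "n * \<sigma>\<^sup>2 = (sqrt n)\<^sup>2 * \<sigma>\<^sup>2" using pos by simp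
    also have "\<dots> = \<sigma> * sqrt n / (R * sqrt \<Theta>) * (\<sigma> * R * (sqrt n * sqrt \<Theta>))"
      using pos by (simp add: power2_eq_square)
    also have "\<dots> \<le> \<beta> * b"
      using pos T \<beta>_pos \<beta>_ge(2) unfolding b_def real_sqrt_mult by (intro mult_mono mult_left_mono) auto
    finally have 1: "n * \<sigma>\<^sup>2 \<le> \<beta> * b" .
    have "(L * R)\<^sup>2 * \<tau> = L * (L * R\<^sup>2 * \<tau>)" by (simp add: power2_eq_square)
    also have "\<dots> \<le> \<beta> * a"
      using pos T \<beta>_pos \<beta>_ge(1) unfolding a_def by (intro mult_mono mult_left_mono) auto
    finally have 2: "(L * R)\<^sup>2 * \<tau> \<le> \<beta> * a" .
    have "max (n * \<sigma>\<^sup>2) ((L * R)\<^sup>2 * \<tau>) \<le> \<beta> * max a b"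
    proof (rule max.boundedI)
      show "n * \<sigma>\<^sup>2 \<le> \<beta> * max a b"
        by (rule order_trans[OF 1]) (use \<beta>_pos in \<open>auto intro: mult_left_mono\<close>)
      show "(L * R)\<^sup>2 * \<tau> \<le> \<beta> * max a b"
        by (rule order_trans[OF 2]) (use \<beta>_pos in \<open>auto intro: mult_left_mono\<close>)
    qed
    then show ?thesis using \<beta>_pos by (simp add: field_simps)
  qed
  ultimately have "\<beta> * R\<^sup>2 * \<Theta> + R * max (\<sigma> * sqrt (\<tau> * n)) (L * R * \<tau>)
      + inverse \<beta> * max (n * \<sigma>\<^sup>2) ((L * R)\<^sup>2 * \<tau>) \<le> 4 * max a b"
    using a b by linarith
  then have "(\<beta> * R\<^sup>2 * \<Theta> + R * max (\<sigma> * sqrt (\<tau> * n)) (L * R * \<tau>)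
      + inverse \<beta> * max (n * \<sigma>\<^sup>2) ((L * R)\<^sup>2 * \<tau>)) / n \<le> 4 * max a b / n"
    using pos by (intro divide_right_mono) auto
  also have "\<dots> = 4 * max (a / n) (b / n)"
    using pos by (simp add: max_def divide_le_cancel)
  also have "b / n = \<sigma> * R * sqrt (T / n)"
  proof -
    have "sqrt (n * T) = n * sqrt (T / n)"
      using pos by (simp add: real_sqrt_mult real_sqrt_divide field_simps flip: power2_eq_square)
    then show ?thesis using pos by (simp add: b_def)
  qed
  finally show ?thesis by (simp add: a_def T_def)
qed

context rsmd_setting
begin

text \<open>
The condition \<open>\<tau> \<le> N / \<upsilon>\<^sup>2\<close> for \<open>\<upsilon> \<noteq> 0\<close> says that \<open>\<upsilon> \<sigma> \<le> \<sigma> \<surd>(N / \<tau>)\<close>. Hence all noise bounds are multiples of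
\<open>\<Lambda> = max {\<sigma> \<surd>(N / \<tau>), M}\<close>: the noise is at most \<open>4 M + \<lambda> + 2 \<upsilon> \<sigma> \<le> 8 \<Lambda>\<close>. The constant \<open>108\<close> is \<open>72\<close>, from the
quadratic noise terms, times their weight \<open>3 / 2\<close> in \<open>gap_le\<close>.
\<close>

theorem gap_bound_with_high_probability:
  fixes N :: nat and \<beta> \<tau> lam :: real
  assumes N: "1 \<le> N" and \<beta>: "0 < \<beta>" and \<tau>: "0 < \<tau>"
    and \<upsilon>\<tau>: "\<upsilon> \<noteq> 0 \<longrightarrow> \<tau> \<le> real N / \<upsilon>\<^sup>2"
    and lam: "lam = max (\<sigma> * sqrt (real N / \<tau>)) (L * R) + \<upsilon> * \<sigma>"
  defines "x \<equiv> rsmd_iter X \<psi> V (\<lambda>_. \<beta>) (truncated_oracle nrm L G \<sigma> xbar gbar \<upsilon> lam) x0"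
  shows "\<exists>A\<in>sets (\<Pi>\<^sub>M i\<in>{1..N}. P). 1 - 2 * exp (- \<tau>) \<le> measure (\<Pi>\<^sub>M i\<in>{1..N}. P) A \<and>
    (\<forall>\<omega>\<in>A. \<forall>z\<in>X. \<beta> * gap d\<phi> \<psi> V (\<lambda>_. \<beta>) N (x \<omega>) z
      \<le> 108 * (\<beta> * R\<^sup>2 * proxy_range nrm \<theta> + R * max (\<sigma> * sqrt (\<tau> * real N)) (L * R * \<tau>)
          + inverse \<beta> * max (real N * \<sigma>\<^sup>2) ((L * R)\<^sup>2 * \<tau>)))"
proof -
  define \<Lambda> where "\<Lambda> = max (\<sigma> * sqrt (real N / \<tau>)) (L * R)"
  define K where "K = max (\<sigma> * sqrt (\<tau> * real N)) (L * R * \<tau>)"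
  define K2 where "K2 = max (real N * \<sigma>\<^sup>2) ((L * R)\<^sup>2 * \<tau>)"
  let ?\<Theta> = "proxy_range nrm \<theta>"
  have pos: "0 < L * R" "0 < real N" "0 \<le> \<upsilon> * \<sigma>" "0 < R"
    using L_pos R_pos N \<upsilon>_nonneg \<sigma>_pos by auto
  have \<Lambda>: "L * R \<le> \<Lambda>" "0 < \<Lambda>" "\<sigma> * sqrt (real N / \<tau>) \<le> \<Lambda>" using pos by (auto simp: \<Lambda>_def)
  have lam\<Lambda>: "lam = \<Lambda> + \<upsilon> * \<sigma>" by (simp add: lam \<Lambda>_def)
  note bounds = truncation_level_bounds[OF \<sigma>_pos pos(2) \<tau> pos(1) \<Lambda>_def, folded K_def K2_def]
  have \<upsilon>\<Lambda>: "\<upsilon> * \<sigma> \<le> \<Lambda>"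
  proof (cases "\<upsilon> = 0")
    case False
    then have "\<upsilon>\<^sup>2 \<le> real N / \<tau>"
      using \<upsilon>\<tau> \<tau> by (simp add: field_simps)
    then have "\<upsilon> * \<sigma> \<le> sqrt (real N / \<tau>) * \<sigma>"
      using \<sigma>_pos by (intro mult_right_mono real_le_rsqrt) auto
    then show ?thesis using \<Lambda>(3) by (simp add: mult.commute)
  qed (use \<Lambda> in simp)
  interpret run: rsmd_run P nrm X \<Phi> d\<phi> \<psi> L G \<sigma> xbar gbar \<upsilon> \<theta> \<theta>' x0 R lam \<beta>
    by unfold_locales (use \<Lambda>(1) lam\<Lambda> \<beta> in auto)
  have noise: "dual_norm nrm (run.noise y w) \<le> 8 * \<Lambda>" if "y \<in> X" for y w
    using run.noise_le[OF that, of w] \<Lambda>(1) \<upsilon>\<Lambda> lam\<Lambda> by linarith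
  obtain A where A: "A \<in> sets (\<Pi>\<^sub>M i\<in>{1..N}. P)"
      "1 - 2 * exp (- \<tau>) \<le> measure (\<Pi>\<^sub>M i\<in>{1..N}. P) A"
    and drift: "\<And>\<omega>. \<omega> \<in> A \<Longrightarrow> (\<Sum>k=1..N. run.drift k \<omega>)
      \<le> real N * (6 * R * \<sigma>\<^sup>2 / lam + 8 * R * \<sigma>\<^sup>2 / (8 * \<Lambda>)) + 2 * R * (8 * \<Lambda>) * \<tau>"
    and squares: "\<And>\<omega>. \<omega> \<in> A \<Longrightarrow> (\<Sum>k=1..N. run.noise_square k \<omega>)
      \<le> real N * (8 * \<sigma>\<^sup>2) + (8 * \<Lambda>)\<^sup>2 * \<tau>"
    using run.high_probability_event[of "8 * \<Lambda>" N \<tau>] noise \<Lambda>(2) by auto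
  have drift_le: "real N * (6 * R * \<sigma>\<^sup>2 / lam + 8 * R * \<sigma>\<^sup>2 / (8 * \<Lambda>)) + 2 * R * (8 * \<Lambda>) * \<tau> \<le> 23 * R * K"
  proof -
    have "6 * R * \<sigma>\<^sup>2 / lam \<le> 6 * R * \<sigma>\<^sup>2 / \<Lambda>"
      using pos \<Lambda> lam\<Lambda> by (intro divide_left_mono) auto
    then have "real N * (6 * R * \<sigma>\<^sup>2 / lam + 8 * R * \<sigma>\<^sup>2 / (8 * \<Lambda>))
        \<le> real N * (6 * R * \<sigma>\<^sup>2 / \<Lambda> + R * \<sigma>\<^sup>2 / \<Lambda>)"
      by (intro mult_left_mono add_mono) auto
    also have "\<dots> = 7 * R * (real N * \<sigma>\<^sup>2 / \<Lambda>)"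
      using \<Lambda>(2) by (simp add: field_simps)
    also have "\<dots> \<le> 7 * R * K"
      using pos bounds(1) by (intro mult_left_mono) auto
    finally have "real N * (6 * R * \<sigma>\<^sup>2 / lam + 8 * R * \<sigma>\<^sup>2 / (8 * \<Lambda>)) \<le> 7 * R * K" .
    moreover have "2 * R * (8 * \<Lambda>) * \<tau> = 16 * R * K"
      using bounds(2) by (simp add: mult_ac)
    ultimately show ?thesis by linarith
  qed
  have squares_le: "real N * (8 * \<sigma>\<^sup>2) + (8 * \<Lambda>)\<^sup>2 * \<tau> \<le> 72 * K2"
  proof -
    have "real N * \<sigma>\<^sup>2 \<le> K2" by (simp add: K2_def)
    then show ?thesis using bounds(3) by (simp add: power_mult_distrib)
  qed
  have "\<beta> * gap d\<phi> \<psi> V (\<lambda>_. \<beta>) N (x \<omega>) z \<le> 108 * (\<beta> * R\<^sup>2 * ?\<Theta> + R * K + inverse \<beta> * K2)"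
    if \<omega>: "\<omega> \<in> A" and z: "z \<in> X" for \<omega> z
  proof -
    have "gap d\<phi> \<psi> V (\<lambda>_. \<beta>) N (x \<omega>) z
        \<le> 2 * V x0 z + (\<Sum>k=1..N. run.drift k \<omega>) / \<beta>
          + 3 / (2 * \<beta>\<^sup>2) * (\<Sum>k=1..N. run.noise_square k \<omega>)"
      unfolding x_def run.drift_def run.noise_square_def by (rule run.gap_le[OF z])
    also have "\<dots> \<le> 2 * (R\<^sup>2 * ?\<Theta>) + 23 * R * K / \<beta> + 3 / (2 * \<beta>\<^sup>2) * (72 * K2)"
      using \<beta> drift[OF \<omega>] squares[OF \<omega>] drift_le squares_le
      by (intro add_mono mult_left_mono divide_right_mono bregman_x0_le z) auto
    finally have "\<beta> * gap d\<phi> \<psi> V (\<lambda>_. \<beta>) N (x \<omega>) z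
        \<le> \<beta> * (2 * (R\<^sup>2 * ?\<Theta>) + 23 * R * K / \<beta> + 3 / (2 * \<beta>\<^sup>2) * (72 * K2))"
      using \<beta> by (intro mult_left_mono) auto
    also have "\<dots> = 2 * (\<beta> * R\<^sup>2 * ?\<Theta>) + 23 * (R * K) + 108 * (inverse \<beta> * K2)"
      using \<beta> by (simp add: field_simps power2_eq_square)
    also have "\<dots> \<le> 108 * (\<beta> * R\<^sup>2 * ?\<Theta> + R * K + inverse \<beta> * K2)"
    proof -
      have "0 \<le> \<beta> * R\<^sup>2 * ?\<Theta>" "0 \<le> R * K"
        using \<beta> proxy_range_pos pos \<tau> \<sigma>_pos by (auto simp: K_def le_max_iff_disj)
      moreover have "2 * a + 23 * b + 108 * c \<le> 108 * (a + b + c)" if "0 \<le> a" "0 \<le> b" for a b c :: real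
        using that by simp
      ultimately show ?thesis by blast
    qed
    finally show ?thesis .
  qed
  then show ?thesis using A unfolding K_def K2_def by blast
qed

end

theorem theorem1:
  "\<exists>C C1 C2. absolute_constant C \<and> absolute_constant C1 \<and> absolute_constant C2 \<and>
    (\<forall>(P :: 'w measure) (nrm :: 'e::euclidean_space \<Rightarrow> real) X \<Phi> d\<phi> \<psi> L G \<sigma> xbar gbar \<upsilon> \<theta> \<theta>' x0 R
       (N :: nat) (\<beta>bar :: real) (\<tau> :: real).
      rsmd_setting P nrm X \<Phi> d\<phi> \<psi> L G \<sigma> xbar gbar \<upsilon> \<theta> \<theta>' x0 R \<longrightarrow>
      1 \<le> N \<longrightarrow> 2 * L \<le> \<beta>bar \<longrightarrow> 1 \<le> \<tau> \<longrightarrow> (\<upsilon> \<noteq> 0 \<longrightarrow> \<tau> \<le> real N / \<upsilon>\<^sup>2) \<longrightarrow>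
      (let M = L * R;
           \<Theta> = proxy_range nrm \<theta>;
           lam = max (\<sigma> * sqrt (real N / \<tau>)) M + \<upsilon> * \<sigma>;
           F = (\<lambda>x. expected_value P \<Phi> x + \<psi> x);
           Fstar = (INF x\<in>X. F x);
           V = bregman (scaled_proxy \<theta> x0 R) (scaled_proxy_grad \<theta>' x0 R);
           \<beta> = (\<lambda>i. \<beta>bar);
           Y = truncated_oracle nrm L G \<sigma> xbar gbar \<upsilon> lam;
           x = rsmd_iter X \<psi> V \<beta> Y x0;
           xhat = (\<lambda>\<omega>. weighted_average \<beta> N (x \<omega>));
           PN = (\<Pi>\<^sub>M i\<in>{1..N}. P)
       in \<exists>A \<in> sets PN. measure PN A \<ge> 1 - 2 * exp (- \<tau>) \<and>
            (\<forall>\<omega>\<in>A.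
               F (xhat \<omega>) - Fstar \<le> \<beta>bar / real N * (SUP z\<in>X. gap d\<phi> \<psi> V \<beta> N (x \<omega>) z) \<and>
               \<beta>bar / real N * (SUP z\<in>X. gap d\<phi> \<psi> V \<beta> N (x \<omega>) z)
                 \<le> C / real N * (\<beta>bar * R\<^sup>2 * \<Theta>
                      + R * max (\<sigma> * sqrt (\<tau> * real N)) (M * \<tau>)
                      + inverse \<beta>bar * max (real N * \<sigma>\<^sup>2) (M\<^sup>2 * \<tau>)) \<and>
               (\<beta>bar = max (2 * L) (\<sigma> * sqrt (real N) / (R * sqrt \<Theta>)) \<longrightarrow>
                 F (xhat \<omega>) - Fstar
                   \<le> max (C1 * (L * R\<^sup>2 * max \<tau> \<Theta> / real N))
                         (C2 * \<sigma> * R * sqrt (max \<tau> \<Theta> / real N))))))"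
proof (rule exI[of _ 108], rule exI[of _ 432], rule exI[of _ 432], intro conjI allI impI, goal_cases)
  case (4 P nrm X \<Phi> d\<phi> \<psi> L G \<sigma> xbar gbar \<upsilon> \<theta> \<theta>' x0 R N \<beta>bar \<tau>)
  note setting = 4(1) and N = 4(2) and \<beta>bar = 4(3) and \<tau> = 4(4) and \<upsilon>\<tau> = 4(5)
  interpret rsmd_setting P nrm X \<Phi> d\<phi> \<psi> L G \<sigma> xbar gbar \<upsilon> \<theta> \<theta>' x0 R by (rule setting)
  define lam where "lam = max (\<sigma> * sqrt (real N / \<tau>)) (L * R) + \<upsilon> * \<sigma>"
  have \<beta>_pos: "0 < \<beta>bar" using \<beta>bar L_pos by linarith
  interpret rsmd_run P nrm X \<Phi> d\<phi> \<psi> L G \<sigma> xbar gbar \<upsilon> \<theta> \<theta>' x0 R lam \<beta>bar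
    by unfold_locales (simp_all add: lam_def \<beta>_pos)
  define x where "x = iter"
  define Fhat where "Fhat \<omega> = expected_value P \<Phi> (weighted_average (\<lambda>_. \<beta>bar) N (x \<omega>))
    + \<psi> (weighted_average (\<lambda>_. \<beta>bar) N (x \<omega>))" for \<omega>
  define Fstar where "Fstar = (INF z\<in>X. expected_value P \<Phi> z + \<psi> z)"
  define g where "g \<omega> z = gap d\<phi> \<psi> V (\<lambda>_. \<beta>bar) N (x \<omega>) z" for \<omega> z
  define K where "K = \<beta>bar * R\<^sup>2 * proxy_range nrm \<theta> + R * max (\<sigma> * sqrt (\<tau> * real N)) (L * R * \<tau>)
    + inverse \<beta>bar * max (real N * \<sigma>\<^sup>2) ((L * R)\<^sup>2 * \<tau>)"
  have "0 < \<tau>" using \<tau> by simp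
  obtain A where A: "A \<in> sets (\<Pi>\<^sub>M i\<in>{1..N}. P)"
      "1 - 2 * exp (- \<tau>) \<le> measure (\<Pi>\<^sub>M i\<in>{1..N}. P) A"
    and gap: "\<And>\<omega> z. \<omega> \<in> A \<Longrightarrow> z \<in> X \<Longrightarrow> \<beta>bar * g \<omega> z \<le> 108 * K"
    using gap_bound_with_high_probability[OF N \<beta>_pos \<open>0 < \<tau>\<close> \<upsilon>\<tau> lam_def]
    unfolding g_def x_def K_def by blast
  have N0: "0 < real N" using N by simp
  have upper: "g \<omega> z \<le> 108 * K / \<beta>bar" if "\<omega> \<in> A" "z \<in> X" for \<omega> z
    using gap[OF that] \<beta>_pos by (simp add: field_simps)
  then have bdd: "bdd_above (g \<omega> ` X)" if "\<omega> \<in> A" for \<omega>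
    using that by (intro bdd_aboveI[of _ "108 * K / \<beta>bar"]) auto
  have first: "Fhat \<omega> - Fstar \<le> \<beta>bar / real N * (SUP z\<in>X. g \<omega> z)" if \<omega>: "\<omega> \<in> A" for \<omega>
  proof -
    have "Fhat \<omega> - \<beta>bar / real N * (SUP z\<in>X. g \<omega> z) \<le> Fstar"
      unfolding Fstar_def
    proof (rule cINF_greatest)
      fix z assume z: "z \<in> X"
      have "Fhat \<omega> - (expected_value P \<Phi> z + \<psi> z) \<le> \<beta>bar / real N * g \<omega> z"
        unfolding Fhat_def g_def x_def by (rule optimality_gap_le[OF \<beta>bar N z])
      also have "\<dots> \<le> \<beta>bar / real N * (SUP z\<in>X. g \<omega> z)"
        using \<beta>_pos N0 by (intro mult_left_mono cSUP_upper z bdd[OF \<omega>]) auto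
      finally show "Fhat \<omega> - \<beta>bar / real N * (SUP z\<in>X. g \<omega> z) \<le> expected_value P \<Phi> z + \<psi> z"
        by linarith
    qed (rule X)
    then show ?thesis by linarith
  qed
  have second: "\<beta>bar / real N * (SUP z\<in>X. g \<omega> z) \<le> 108 / real N * K" if \<omega>: "\<omega> \<in> A" for \<omega>
  proof -
    have "(SUP z\<in>X. g \<omega> z) \<le> 108 * K / \<beta>bar"
      by (intro cSUP_least X upper \<omega>)
    then have "\<beta>bar / real N * (SUP z\<in>X. g \<omega> z) \<le> \<beta>bar / real N * (108 * K / \<beta>bar)"
      using \<beta>_pos N0 by (intro mult_left_mono) auto
    then show ?thesis using \<beta>_pos by simp
  qed
  \<comment> \<open>\<open>432\<close> is \<open>4\<close>, from the choice of the step size, times \<open>108\<close>\<close>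
  have third: "Fhat \<omega> - Fstar \<le> max (432 * (L * R\<^sup>2 * max \<tau> (proxy_range nrm \<theta>) / real N))
      (432 * \<sigma> * R * sqrt (max \<tau> (proxy_range nrm \<theta>) / real N))"
    if \<omega>: "\<omega> \<in> A" and eq: "\<beta>bar = max (2 * L) (\<sigma> * sqrt (real N) / (R * sqrt (proxy_range nrm \<theta>)))" for \<omega>
  proof -
    have "K / real N \<le> 4 * max (L * R\<^sup>2 * max \<tau> (proxy_range nrm \<theta>) / real N)
        (\<sigma> * R * sqrt (max \<tau> (proxy_range nrm \<theta>) / real N))"
      unfolding K_def
      by (rule step_size_tradeoff[OF L_pos R_pos \<sigma>_pos proxy_range_pos N0 \<open>0 < \<tau>\<close> eq])
    moreover have "Fhat \<omega> - Fstar \<le> 108 * (K / real N)"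
      using first[OF \<omega>] second[OF \<omega>] by simp
    ultimately have "Fhat \<omega> - Fstar \<le> 432 * max (L * R\<^sup>2 * max \<tau> (proxy_range nrm \<theta>) / real N)
        (\<sigma> * R * sqrt (max \<tau> (proxy_range nrm \<theta>) / real N))"
      by linarith
    then show ?thesis by (simp add: max_mult_distrib_left mult.assoc)
  qed
  have "\<exists>A\<in>sets (\<Pi>\<^sub>M i\<in>{1..N}. P). 1 - 2 * exp (- \<tau>) \<le> measure (\<Pi>\<^sub>M i\<in>{1..N}. P) A \<and>
    (\<forall>\<omega>\<in>A. Fhat \<omega> - Fstar \<le> \<beta>bar / real N * (SUP z\<in>X. g \<omega> z) \<and>
      \<beta>bar / real N * (SUP z\<in>X. g \<omega> z) \<le> 108 / real N * K \<and>
      (\<beta>bar = max (2 * L) (\<sigma> * sqrt (real N) / (R * sqrt (proxy_range nrm \<theta>))) \<longrightarrow>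
        Fhat \<omega> - Fstar \<le> max (432 * (L * R\<^sup>2 * max \<tau> (proxy_range nrm \<theta>) / real N))
          (432 * \<sigma> * R * sqrt (max \<tau> (proxy_range nrm \<theta>) / real N))))"
    using A first second third by blast
  then show ?case
    unfolding Let_def Fhat_def Fstar_def g_def K_def x_def lam_def .
qed (simp_all add: absolute_constant_def)

end
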